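(* Let $\mathbb{X},\mathbb{Y}$ be finite dimensional real inner product spaces, $f:\mathbb{X}\to(-\infty,\infty]$ and $g:\mathbb{Y}\to(-\infty,\infty]$ be proper, lower semicontinuous and bounded below, $H:\mathbb{X}\times\mathbb{Y}\to\mathbb{R}$ be a smooth function such that $\nabla_xH(\cdot,y)$ is $L_1(y)$-Lipschitz for each $y$ and $\nabla_yH(x,\cdot)$ is $L_2(x)$-Lipschitz for each $x$, and let $\Psi(x,y):=f(x)+g(y)+H(x,y)$ be coercive and bounded below. Let $\{(x^k,y^k)\}_{k\in\mathbb{N}}$ be the sequence generated by the PALMenls algorithm (described in the context). If $\Psi$ is a KL function of exponent $\theta\in[1/2,1)$, then there exist $\widehat{\varrho}\in(0,1)$ and $\gamma'>0$ such that for all sufficiently large $k$, with $\omega^*:=\lim_{k\to\infty}\Psi(x^k,y^k)$ (this limit exists), $$\Psi(x^k,y^k)-\omega^*\le\begin{cases}\gamma'\,\widehat{\varrho}^{\lceil\frac{k-1}{m+1}\rceil}&\text{if }\theta=1/2,\\ \gamma'\,k^{\frac{1-\theta}{1-2\theta}}&\text{if }\theta\in(1/2,1).\end{cases}$$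
   Context: $\partial$ is the limiting (Mordukhovich) subdifferential. For $\tau>0$, $\mathcal{P}_\tau h(x):=\arg\min_{z}\{\frac{1}{2\tau}\|z-x\|^2+h(z)\}$. For $\delta>0$ and $z=(x,y,u,v)\in\mathbb{X}\times\mathbb{Y}\times\mathbb{X}\times\mathbb{Y}$, $\Upsilon_\delta(z):=f(x)+g(y)+H(x,y)+\frac{\delta}{2}\|x-u\|^2+\frac{\delta}{2}\|y-v\|^2$. Products carry the product Euclidean norm. $[t]_+:=\max(0,t)$. A proper lsc $h$ is a KL function of exponent $\theta\in[0,1)$ if for every $\overline{x}\in\mathrm{dom}\,\partial h$ there exist $c>0$, $\eta\in(0,\infty]$ and a neighborhood $\mathcal{U}$ of $\overline{x}$ such that, with $\varphi(t)=ct^{1-\theta}$, $\varphi'(h(x)-h(\overline{x}))\,\mathrm{dist}(0,\partial h(x))\ge1$ for all $x\in\mathcal{U}$ with $h(\overline{x})<h(x)<h(\overline{x})+\eta$. PALMenls algorithm (nonmonotone line search PALM with extrapolation). Choose an integer $m\ge0$ and $(x^0,y^0)\in\mathrm{dom}\,\Psi$; let $\mathcal{L}_0:=\{(x,y)\,|\,\Psi(x,y)\le\Psi(x^0,y^0)\}$ (compact) and $L:=\max_{(x,y)\in\mathcal{L}_0}\max(L_1(y),L_2(x))$. Parameters: $\delta\in(0,1)$, $\alpha\in(0,\delta/2]$, $0<\underline{\tau}<\frac{1}{L+\delta+2\alpha}<\overline{\tau}$, $\beta_{\max}\ge0$, $\eta,\eta_1,\eta_2\in(0,1)$. Set $(x^{-1},y^{-1})=(x^0,y^0)$,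 $z^0=(x^0,y^0,x^{-1},y^{-1})$. Iteration $k=0,1,2,\ldots$ (run indefinitely): choose any $\beta_{k,0}\in[0,\beta_{\max}]$, $\tau_{1,k}^0,\tau_{2,k}^0\in[\underline{\tau},\overline{\tau}]$; for $l=0,1,2,\ldots$ set $\beta_k=\beta_{k,0}\eta^l$, $\tau_{1,k}=\max\{\tau_{1,k}^0\eta_1^l,\underline{\tau}\}$, $\tau_{2,k}=\max\{\tau_{2,k}^0\eta_2^l,\underline{\tau}\}$, $\widetilde{x}^k=x^k+\beta_k(x^k-x^{k-1})$, pick $x^{k+1}\in\mathcal{P}_{\tau_{1,k}}f(\widetilde{x}^k-\tau_{1,k}\nabla_xH(\widetilde{x}^k,y^k))$, $\widetilde{y}^k=y^k+\beta_k(y^k-y^{k-1})$, pick $y^{k+1}\in\mathcal{P}_{\tau_{2,k}}g(\widetilde{y}^k-\tau_{2,k}\nabla_yH(x^{k+1},\widetilde{y}^k))$, $z^{k+1}=(x^{k+1},y^{k+1},x^k,y^k)$, and stop the inner loop (accepting the point) as soon as $\Upsilon_\delta(z^{k+1})\le\max_{j=[k-m]_+,\ldots,k}\Upsilon_\delta(z^j)-\frac{\alpha}{2}\|z^{k+1}-z^k\|^2$. Standing conventions: with $B_1,B_2$ balls centered at the origin containing $\{(1+2\beta_{\max})x^k\}_k$ and $\{(1+2\beta_{\max})y^k\}_k$ respectively, the quantities $L$, $M:=\sup_{x\ne x'\in B_1,\,y\ne y'\in B_2}\frac{\|\nabla_xH(x,y)-\nabla_xH(x',y')\|}{\|(x,y)-(x',y')\|}$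 and $\overline{L}_2:=\sup_{x\in B_1}L_2(x)$ are finite. *)

theory Defs
  imports "HOL-Analysis.Analysis"
begin

text \<open>Functions with values in $(-\infty,\infty]$ are rendered with value type \<^typ>\<open>ereal\<close>;
  \<open>proper_fun\<close> excludes the value $-\infty$.\<close>

definition proper_fun :: "('a \<Rightarrow> ereal) \<Rightarrow> bool" where
  "proper_fun h \<longleftrightarrow> (\<forall>x. h x \<noteq> -\<infinity>) \<and> (\<exists>x. h x \<noteq> \<infinity>)"

definition lsc_fun :: "('a::topological_space \<Rightarrow> ereal) \<Rightarrow> bool" where
  "lsc_fun h \<longleftrightarrow> (\<forall>x. h x \<le> Liminf (at x) h)"

definition bounded_below :: "('a \<Rightarrow> ereal) \<Rightarrow> bool" where
  "bounded_below h \<longleftrightarrow> (\<exists>b::real. \<forall>x. ereal b \<le> h x)"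

definition coercive :: "('a::real_normed_vector \<Rightarrow> ereal) \<Rightarrow> bool" where
  "coercive h \<longleftrightarrow> (h \<longlongrightarrow> \<infinity>) at_infinity"

definition frechet_subdiff :: "('a::real_inner \<Rightarrow> ereal) \<Rightarrow> 'a \<Rightarrow> 'a set" where
  "frechet_subdiff h x = {v. \<bar>h x\<bar> \<noteq> \<infinity> \<and>
     0 \<le> Liminf (at x) (\<lambda>y. (h y - h x - ereal (v \<bullet> (y - x))) / ereal (norm (y - x)))}"

definition limiting_subdiff :: "('a::real_inner \<Rightarrow> ereal) \<Rightarrow> 'a \<Rightarrow> 'a set" where
  "limiting_subdiff h x = {v. \<bar>h x\<bar> \<noteq> \<infinity> \<and>
     (\<exists>X V. X \<longlonglongrightarrow> x \<and> (\<lambda>n. h (X n)) \<longlonglongrightarrow> h x \<and>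
            (\<forall>n. V n \<in> frechet_subdiff h (X n)) \<and> V \<longlonglongrightarrow> v)}"

text \<open>Unlike \<^const>\<open>infdist\<close>, the distance to the empty set is $\infty$ here, so that the
  Kurdyka-Lojasiewicz inequality is vacuous outside the domain of the subdifferential.\<close>

definition edist_set :: "'a::metric_space \<Rightarrow> 'a set \<Rightarrow> ereal" where
  "edist_set x S = (INF v\<in>S. ereal (dist x v))"

definition KL_exponent :: "('a::real_inner \<Rightarrow> ereal) \<Rightarrow> real \<Rightarrow> bool" where
  "KL_exponent h \<theta> \<longleftrightarrow> proper_fun h \<and> lsc_fun h \<and> 0 \<le> \<theta> \<and> \<theta> < 1 \<and>
     (\<forall>xb. limiting_subdiff h xb \<noteq> {} \<longrightarrow>
       (\<exists>(c::real) (\<eta>::ereal) U. c > 0 \<and> \<eta> > 0 \<and> open U \<and> xb \<in> U \<and>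
         (\<forall>x\<in>U. h xb < h x \<and> h x < h xb + \<eta> \<longrightarrow>
            1 \<le> ereal (deriv (\<lambda>t. c * t powr (1 - \<theta>)) (real_of_ereal (h x - h xb)))
                 * edist_set 0 (limiting_subdiff h x))))"

definition prox :: "real \<Rightarrow> ('a::real_inner \<Rightarrow> ereal) \<Rightarrow> 'a \<Rightarrow> 'a set" where
  "prox \<tau> h x = {z. is_arg_min (\<lambda>z. ereal (1 / (2 * \<tau>) * (norm (z - x))\<^sup>2) + h z) (\<lambda>_. True) z}"

definition gradient :: "('a::real_inner \<Rightarrow> real) \<Rightarrow> 'a \<Rightarrow> 'a" where
  "gradient h x = (THE D. GDERIV h x :> D)"

definition gradient_x :: "('a::real_inner \<times> 'b::real_inner \<Rightarrow> real) \<Rightarrow> 'a \<Rightarrow> 'b \<Rightarrow> 'a" where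
  "gradient_x H x y = gradient (\<lambda>x'. H (x', y)) x"

definition gradient_y :: "('a::real_inner \<times> 'b::real_inner \<Rightarrow> real) \<Rightarrow> 'a \<Rightarrow> 'b \<Rightarrow> 'b" where
  "gradient_y H x y = gradient (\<lambda>y'. H (x, y')) y"

text \<open>``Smooth'' is read as continuously differentiable, the weakest usual reading.\<close>

definition smooth_fun :: "('a::real_inner \<Rightarrow> real) \<Rightarrow> bool" where
  "smooth_fun h \<longleftrightarrow> (\<forall>x. h differentiable at x) \<and> continuous_on UNIV (gradient h)"

definition Psi :: "('a \<Rightarrow> ereal) \<Rightarrow> ('b \<Rightarrow> ereal) \<Rightarrow> ('a \<times> 'b \<Rightarrow> real) \<Rightarrow> 'a \<times> 'b \<Rightarrow> ereal" where
  "Psi f g H = (\<lambda>(x, y). f x + g y + ereal (H (x, y)))"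

definition Upsilon :: "('a::real_inner \<Rightarrow> ereal) \<Rightarrow> ('b::real_inner \<Rightarrow> ereal) \<Rightarrow> ('a \<times> 'b \<Rightarrow> real)
    \<Rightarrow> real \<Rightarrow> 'a \<times> 'b \<times> 'a \<times> 'b \<Rightarrow> ereal" where
  "Upsilon f g H \<delta> = (\<lambda>(x, y, u, v). f x + g y + ereal (H (x, y))
     + ereal (\<delta> / 2 * (norm (x - u))\<^sup>2) + ereal (\<delta> / 2 * (norm (y - v))\<^sup>2))"

text \<open>The convention $(x^{-1},y^{-1})=(x^0,y^0)$ is built in: on natural numbers \<open>0 - 1 = 0\<close>.\<close>

definition zseq :: "(nat \<Rightarrow> 'a) \<Rightarrow> (nat \<Rightarrow> 'b) \<Rightarrow> nat \<Rightarrow> 'a \<times> 'b \<times> 'a \<times> 'b" where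
  "zseq x y k = (x k, y k, x (k - 1), y (k - 1))"

text \<open>\<open>palm_step\<close> relates the current pair \<open>(x, y)\<close> and the previous pair \<open>(xp, yp)\<close> to a possible
  trial point \<open>(xn, yn)\<close>; the second update uses the new first block \<open>xn\<close>.\<close>

definition palm_step ::
  "('a::real_inner \<Rightarrow> ereal) \<Rightarrow> ('b::real_inner \<Rightarrow> ereal) \<Rightarrow> ('a \<times> 'b \<Rightarrow> real)
    \<Rightarrow> real \<Rightarrow> real \<Rightarrow> real \<Rightarrow> 'a \<times> 'b \<Rightarrow> 'a \<times> 'b \<Rightarrow> 'a \<times> 'b \<Rightarrow> bool" where
  "palm_step f g H \<beta> \<tau>1 \<tau>2 = (\<lambda>(xp, yp) (x, y) (xn, yn).
     let xt = x + \<beta> *\<^sub>R (x - xp); yt = y + \<beta> *\<^sub>R (y - yp) in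
       xn \<in> prox \<tau>1 f (xt - \<tau>1 *\<^sub>R gradient_x H xt y) \<and>
       yn \<in> prox \<tau>2 g (yt - \<tau>2 *\<^sub>R gradient_y H xn yt))"

text \<open>The acceptance test at iteration \<open>k\<close> for a trial point \<open>(xn, yn)\<close>.
  Truncated subtraction makes \<open>k - m\<close> equal to $[k-m]_+$.\<close>

definition nls_accept ::
  "('a::real_inner \<Rightarrow> ereal) \<Rightarrow> ('b::real_inner \<Rightarrow> ereal) \<Rightarrow> ('a \<times> 'b \<Rightarrow> real)
    \<Rightarrow> real \<Rightarrow> real \<Rightarrow> nat \<Rightarrow> (nat \<Rightarrow> 'a) \<Rightarrow> (nat \<Rightarrow> 'b) \<Rightarrow> nat \<Rightarrow> 'a \<times> 'b \<Rightarrow> bool" where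
  "nls_accept f g H \<delta> \<alpha> m x y k = (\<lambda>(xn, yn).
     Upsilon f g H \<delta> (xn, yn, x k, y k)
       \<le> (MAX j\<in>{k - m..k}. Upsilon f g H \<delta> (zseq x y j))
          - ereal (\<alpha> / 2 * (norm ((xn, yn, x k, y k) - zseq x y k))\<^sup>2))"

text \<open>\<open>(x, y)\<close> is a possible run of the algorithm. In iteration \<open>k\<close>, \<open>w l\<close> is the point picked in the
  \<open>l\<close>-th inner trial and \<open>n\<close> is the index of the first accepted trial. The prox mappings are
  set-valued, so every pick, rejected ones included, is quantified existentially.\<close>

definition PALMenls ::
  "('a::real_inner \<Rightarrow> ereal) \<Rightarrow> ('b::real_inner \<Rightarrow> ereal) \<Rightarrow> ('a \<times> 'b \<Rightarrow> real)
    \<Rightarrow> real \<Rightarrow> real \<Rightarrow> real \<Rightarrow> real \<Rightarrow> real \<Rightarrow> real \<Rightarrow> real \<Rightarrow> real \<Rightarrow> nat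
    \<Rightarrow> (nat \<Rightarrow> 'a) \<Rightarrow> (nat \<Rightarrow> 'b) \<Rightarrow> bool" where
  "PALMenls f g H \<delta> \<alpha> \<tau>min \<tau>max \<beta>max \<eta> \<eta>1 \<eta>2 m x y \<longleftrightarrow>
     (\<forall>k. \<exists>\<beta>0\<in>{0..\<beta>max}. \<exists>\<tau>1\<in>{\<tau>min..\<tau>max}. \<exists>\<tau>2\<in>{\<tau>min..\<tau>max}. \<exists>(w :: nat \<Rightarrow> 'a \<times> 'b) n.
        (\<forall>l\<le>n. palm_step f g H (\<beta>0 * \<eta> ^ l) (max (\<tau>1 * \<eta>1 ^ l) \<tau>min) (max (\<tau>2 * \<eta>2 ^ l) \<tau>min)
                  (x (k - 1), y (k - 1)) (x k, y k) (w l)) \<and>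
        (\<forall>l<n. \<not> nls_accept f g H \<delta> \<alpha> m x y k (w l)) \<and>
        nls_accept f g H \<delta> \<alpha> m x y k (w n) \<and>
        (x (Suc k), y (Suc k)) = w n)"

definition origin_ball :: "'a::real_normed_vector set \<Rightarrow> bool" where
  "origin_ball B \<longleftrightarrow> (\<exists>r>0. B = ball 0 r \<or> B = cball 0 r)"

end

theory Submission
  imports Defs
begin

text \<open>Completing the square in the prox inclusions gives, with $F(x,y) = f(x) + g(y)$ and
  $w^k = (x^k, y^k)$, vectors $p^k$ such that
  $F(z) \ge F(w^k) + \langle p^k, z - w^k\rangle - \kappa\|z - w^k\|^2$ for all $z$ and
  $\|p^k + \nabla H(w^k)\| \le C\|z^k - z^{k-1}\|$. Everything else follows from this inequality. Taking
  $z = w^{k-1}$ bounds the possible increase of $\Upsilon_\delta(z^k)$ by a multiple of the step length, so the line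
  search makes the whole sequence $\Upsilon_\delta(z^k)$ converge and the steps vanish; taking $z$ to be a cluster
  point shows that $\Psi$ equals the limit $\omega^*$ there; and $p^k + \nabla H(w^k) \in \partial\Psi(w^k)$. The KL
  inequality then yields $(\Upsilon_\delta(z^k) - \omega^*)_+^{2\theta} \le A\|z^k - z^{k-1}\|^2$, and the window maxima
  $V_k$ of $\Upsilon_\delta(z^k) - \omega^*$ satisfy $V_{k+m+1} + A' V_{k+m+1}^{2\theta} \le V_k$, which is a
  geometric contraction for $\theta = 1/2$ and gives $V_k = O(k^{1/(1-2\theta)})$ for $\theta > 1/2$.\<close>

section \<open>Nonmonotone descent sequences\<close>

text \<open>Truncated subtraction turns \<open>k - m\<close> into the index $[k-m]_+$ of the line
  search, so the first windows are merely shorter and no window is empty.\<close>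

definition window_max :: "nat \<Rightarrow> (nat \<Rightarrow> real) \<Rightarrow> nat \<Rightarrow> real" where
  "window_max m u k = Max (u ` {k - m..k})"

lemma window_max_ge: "k - m \<le> j \<Longrightarrow> j \<le> k \<Longrightarrow> u j \<le> window_max m u k"
  unfolding window_max_def by (rule Max_ge) auto

lemma window_max_attained:
  obtains j where "k - m \<le> j" "j \<le> k" "u j = window_max m u k"
proof -
  have "window_max m u k \<in> u ` {k - m..k}"
    unfolding window_max_def by (rule Max_in) auto
  then show ?thesis using that by auto
qed

lemma window_max_diff_const: "window_max m (\<lambda>k. u k - c) k = window_max m u k - c"
proof (rule antisym)
  show "window_max m (\<lambda>k. u k - c) k \<le> window_max m u k - c"
    using window_max_attained[of k m "\<lambda>k. u k - c"] window_max_ge[of k m _ u] by (metis diff_right_mono)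
  show "window_max m u k - c \<le> window_max m (\<lambda>k. u k - c) k"
    using window_max_attained[of k m u] window_max_ge[of k m _ "\<lambda>k. u k - c"] by metis
qed

text \<open>Passing from \<open>k\<close> to \<open>Suc k\<close>, the window gains only the index
  \<open>Suc k\<close>, and the value there is bounded by the old maximum.\<close>

lemma decseq_window_max:
  assumes "\<And>k. u (Suc k) \<le> window_max m u k"
  shows "decseq (window_max m u)"
proof (rule decseq_SucI)
  fix k
  obtain j where j: "Suc k - m \<le> j" "j \<le> Suc k" "u j = window_max m u (Suc k)"
    by (rule window_max_attained)
  show "window_max m u (Suc k) \<le> window_max m u k"
  proof (cases "j = Suc k")
    case True
    then show ?thesis using assms[of k] j by simp
  next
    case False
    then have "u j \<le> window_max m u k" using j by (intro window_max_ge) auto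
    then show ?thesis using j by simp
  qed
qed

text \<open>The window maxima decrease to some \<omega>; let \<open>l k\<close> be an index where
  the k-th maximum is attained. If the values at \<open>l k - j\<close> tend to \<omega>, then
  \<open>dec\<close> forces the steps there to vanish, and \<open>near\<close> carries the limit one
  index further back. After m such steps every index is reached.\<close>

lemma nonmonotone_descent_tendsto:
  fixes u d :: "nat \<Rightarrow> real"
  assumes a: "0 < a"
    and dec: "\<And>k. u (Suc k) \<le> window_max m u k - a * (d (Suc k))\<^sup>2"
    and near: "\<And>k. u (Suc k) \<le> u k + C * d (Suc k)"
    and bd: "\<And>k. b \<le> u k"
  obtains \<omega> where "u \<longlonglongrightarrow> \<omega>" "d \<longlonglongrightarrow> 0" "\<And>k. \<omega> \<le> window_max m u k"
proof -
  define V where "V = window_max m u"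
  have decV: "decseq V"
    unfolding V_def
  proof (rule decseq_window_max)
    fix k
    have "0 \<le> a * (d (Suc k))\<^sup>2" using a by simp
    then show "u (Suc k) \<le> window_max m u k" using dec[of k] by linarith
  qed
  have "\<And>k. b \<le> V k"
    using bd window_max_ge[of _ m _ u] unfolding V_def
    by (meson order.trans diff_le_self order_refl)
  then obtain \<omega> where V: "V \<longlonglongrightarrow> \<omega>" and V_ge: "\<And>k. \<omega> \<le> V k"
    using decseq_convergent[OF decV] by metis
  have "\<forall>k. \<exists>j. k - m \<le> j \<and> j \<le> k \<and> u j = V k"
    unfolding V_def by (metis window_max_attained)
  then obtain l where l: "\<And>k. k - m \<le> l k" "\<And>k. l k \<le> k" "\<And>k. u (l k) = V k"
    by metis
  have l_top: "filterlim (\<lambda>k. l k - j) sequentially sequentially" for j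
  proof (rule filterlim_at_top_mono)
    show "filterlim (\<lambda>k. k - (m + j)) at_top sequentially"
      by (rule filterlim_minus_const_nat_at_top)
    show "\<forall>\<^sub>F k in sequentially. k - (m + j) \<le> l k - j"
      by (rule always_eventually) (metis diff_diff_left diff_le_mono l(1))
  qed
  have u_l: "(\<lambda>k. u (l k - j)) \<longlonglongrightarrow> \<omega>" for j
  proof (induction j)
    case 0
    then show ?case using V l by simp
  next
    case (Suc j)
    have V1: "(\<lambda>k. V (l k - Suc j)) \<longlonglongrightarrow> \<omega>"
      by (rule filterlim_compose[OF V l_top])
    \<comment> \<open>The hypotheses speak of successor indices. Once \<open>l k - j\<close> is
      positive it is the successor of \<open>l k - Suc j\<close>, so truncation does no
      harm.\<close>
    have pos: "\<forall>\<^sub>F k in sequentially. l k - j = Suc (l k - Suc j)"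
      using eventually_compose_filterlim[OF eventually_gt_at_top[of 0] l_top[of j]]
      by eventually_elim simp
    have "(\<lambda>k. (V (l k - Suc j) - u (l k - j)) / a) \<longlonglongrightarrow> (\<omega> - \<omega>) / a"
      by (intro tendsto_intros V1 Suc) (use a in auto)
    then have "(\<lambda>k. (d (l k - j))\<^sup>2) \<longlonglongrightarrow> 0"
    proof (rule tendsto_sandwich[rotated 3, OF tendsto_eq_rhs])
      show "\<forall>\<^sub>F k in sequentially. (d (l k - j))\<^sup>2 \<le> (V (l k - Suc j) - u (l k - j)) / a"
        using pos
      proof eventually_elim
        case (elim k)
        show ?case using dec[of "l k - Suc j"] a
          by (simp add: V_def flip: elim) (simp add: field_simps)
      qed
    qed (auto)
    \<comment> \<open>The sign of \<open>d\<close> is unknown here: the root of the square is the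
      absolute value of \<open>d\<close>, which suffices for a null sequence.\<close>
    then have "(\<lambda>k. sqrt ((d (l k - j))\<^sup>2)) \<longlonglongrightarrow> sqrt 0" by (rule tendsto_real_sqrt)
    then have d0: "(\<lambda>k. d (l k - j)) \<longlonglongrightarrow> 0" by (simp add: tendsto_rabs_zero_iff)
    have "(\<lambda>k. u (l k - j) - C * d (l k - j)) \<longlonglongrightarrow> \<omega> - C * 0"
      by (intro tendsto_intros Suc d0)
    then have low: "(\<lambda>k. u (l k - j) - C * d (l k - j)) \<longlonglongrightarrow> \<omega>" by simp
    show ?case
    proof (rule tendsto_sandwich[OF _ _ low V1])
      show "\<forall>\<^sub>F k in sequentially. u (l k - j) - C * d (l k - j) \<le> u (l k - Suc j)"
        using pos
      proof eventually_elim
        case (elim k)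
        show ?case using near[of "l k - Suc j"] by (simp flip: elim)
      qed
      show "\<forall>\<^sub>F k in sequentially. u (l k - Suc j) \<le> V (l k - Suc j)"
        unfolding V_def by (intro always_eventually allI window_max_ge) auto
    qed
  qed
  \<comment> \<open>The index k equals \<open>l (k + m) - j\<close> for some j at most m that varies
    with k. Summing the errors over all such j gives one null sequence that dominates the error at
    k.\<close>
  have "(\<lambda>k. \<Sum>j\<le>m. \<bar>u (l (k + m) - j) - \<omega>\<bar>) \<longlonglongrightarrow> (\<Sum>j\<le>m. \<bar>\<omega> - \<omega>\<bar>)"
    using u_l by (intro tendsto_intros) (rule LIMSEQ_ignore_initial_segment)
  then have "(\<lambda>k. \<Sum>j\<le>m. \<bar>u (l (k + m) - j) - \<omega>\<bar>) \<longlonglongrightarrow> 0" by simp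
  then have "(\<lambda>k. u k - \<omega>) \<longlonglongrightarrow> 0"
  proof (rule Lim_null_comparison[rotated])
    show "\<forall>\<^sub>F k in sequentially. norm (u k - \<omega>) \<le> (\<Sum>j\<le>m. \<bar>u (l (k + m) - j) - \<omega>\<bar>)"
    proof (intro always_eventually allI)
      fix k
      have "k \<le> l (k + m)" "l (k + m) \<le> k + m" using l(1)[of "k + m"] l(2)[of "k + m"] by auto
      then have "l (k + m) - (l (k + m) - k) = k" "l (k + m) - k \<le> m" by auto
      then have "\<bar>u k - \<omega>\<bar> = (\<lambda>j. \<bar>u (l (k + m) - j) - \<omega>\<bar>) (l (k + m) - k)" by simp
      also have "\<dots> \<le> (\<Sum>j\<le>m. \<bar>u (l (k + m) - j) - \<omega>\<bar>)"
        by (rule member_le_sum) (use \<open>l (k + m) - k \<le> m\<close> in auto)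
      finally show "norm (u k - \<omega>) \<le> (\<Sum>j\<le>m. \<bar>u (l (k + m) - j) - \<omega>\<bar>)" by simp
    qed
  qed
  then have u: "u \<longlonglongrightarrow> \<omega>" by (simp add: LIM_zero_iff)
  have "(\<lambda>k. (V k - u (Suc k)) / a) \<longlonglongrightarrow> (\<omega> - \<omega>) / a"
    by (intro tendsto_intros V LIMSEQ_Suc[OF u]) (use a in auto)
  then have "(\<lambda>k. (d (Suc k))\<^sup>2) \<longlonglongrightarrow> 0"
  proof (rule tendsto_sandwich[rotated 3, OF tendsto_eq_rhs])
    show "\<forall>\<^sub>F k in sequentially. (d (Suc k))\<^sup>2 \<le> (V k - u (Suc k)) / a"
    proof (intro always_eventually allI)
      fix k
      show "(d (Suc k))\<^sup>2 \<le> (V k - u (Suc k)) / a"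
        using dec[of k] a by (simp add: V_def field_simps)
    qed
  qed auto
  then have "(\<lambda>k. sqrt ((d (Suc k))\<^sup>2)) \<longlonglongrightarrow> sqrt 0" by (rule tendsto_real_sqrt)
  then have "(\<lambda>k. d (Suc k)) \<longlonglongrightarrow> 0" by (simp add: tendsto_rabs_zero_iff)
  then have "d \<longlonglongrightarrow> 0" by (rule LIMSEQ_imp_Suc)
  with u V_ge show ?thesis using that unfolding V_def by blast
qed

text \<open>The windows ending at \<open>k\<close> and at \<open>k + Suc m\<close> are disjoint.
  Hence the later maximum is attained at some \<open>Suc i\<close> with i at least k, where
  \<open>step\<close> applies, and the maximum at i is at most the one at k.\<close>

lemma window_max_contraction:
  fixes v :: "nat \<Rightarrow> real"
  assumes nonneg: "\<And>k. 0 \<le> window_max m v k"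
    and dec: "decseq (window_max m v)"
    and a: "0 \<le> a" and p: "0 < p"
    and step: "\<And>k. K \<le> k \<Longrightarrow> 0 \<le> v (Suc k) \<Longrightarrow> v (Suc k) + a * v (Suc k) powr p \<le> window_max m v k"
    and k: "K \<le> k"
  shows "window_max m v (k + Suc m) + a * window_max m v (k + Suc m) powr p \<le> window_max m v k"
proof -
  obtain j where j: "k + Suc m - m \<le> j" "v j = window_max m v (k + Suc m)"
    using window_max_attained by metis
  then obtain i where i: "j = Suc i" "k \<le> i" by (cases j) auto
  have "v j + a * v j powr p \<le> window_max m v i"
    using step[of i] nonneg[of "k + Suc m"] i j k by simp
  also have "\<dots> \<le> window_max m v k" using dec i by (simp add: decseqD)
  finally show ?thesis using j by simp
qed

section \<open>Convergence rates of contractive recursions\<close>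

lemma contraction_geometric:
  fixes s :: "nat \<Rightarrow> real"
  assumes a: "0 < a" and step: "\<And>n. s (Suc n) + a * s (Suc n) \<le> s n"
  shows "s n \<le> (1 / (1 + a)) ^ n * s 0"
proof (induction n)
  case (Suc n)
  have "s (Suc n) \<le> s n * (1 / (1 + a))" using step[of n] a by (simp add: field_simps)
  also have "\<dots> \<le> ((1 / (1 + a)) ^ n * s 0) * (1 / (1 + a))"
    using Suc a by (intro mult_right_mono) auto
  finally show ?case by (simp add: mult_ac)
qed simp

text \<open>The power is at most exp(s x), and multiplying 1 - t \<le> exp(-t) by exp(t) gives
  exp(t) \<le> 1 + t exp(t). With x = 1/N this bounds the ratio of consecutive values of the
  comparison sequence in the next lemma.\<close>

lemma one_plus_powr_le:
  fixes x s :: real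
  assumes "0 \<le> x" "x \<le> 1" "0 \<le> s"
  shows "(1 + x) powr s \<le> 1 + s * exp s * x"
proof -
  have "(1 + x) powr s = exp (s * ln (1 + x))" using assms by (simp add: powr_def)
  also have "\<dots> \<le> exp (s * x)" using assms by (simp add: ln_add_one_self_le_self mult_left_mono)
  also have "\<dots> \<le> 1 + (s * x) * exp (s * x)"
  proof -
    have "1 + - (s * x) \<le> exp (- (s * x))" by (rule exp_ge_add_one_self)
    then have "(1 - s * x) * exp (s * x) \<le> exp (- (s * x)) * exp (s * x)"
      by (intro mult_right_mono) auto
    then show ?thesis by (simp add: algebra_simps flip: exp_add)
  qed
  also have "\<dots> \<le> 1 + (s * x) * exp s"
    using assms by (intro add_left_mono mult_left_mono) (auto intro: mult_left_le)
  finally show ?thesis by (simp add: mult_ac)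
qed

text \<open>Induction against the comparison sequence C (n+1)^(-s) with s = 1/(p-1). Since t + a t^p
  increases in t, a term above the comparison value b would give b + a b^p < C N^(-s), whereas the
  choice of C makes the comparison sequence satisfy the opposite inequality.\<close>

lemma contraction_sublinear:
  fixes t :: "nat \<Rightarrow> real"
  assumes a: "0 < a" and p: "1 < p" and nonneg: "\<And>n. 0 \<le> t n"
    and step: "\<And>n. t (Suc n) + a * t (Suc n) powr p \<le> t n"
  obtains C where "0 < C" "\<And>n. t n \<le> C * real (Suc n) powr (- (1 / (p - 1)))"
proof -
  define s where "s = 1 / (p - 1)"
  have s: "0 < s" "s * p = s + 1" "s * (p - 1) = 1"
    using p by (auto simp: s_def field_simps)
  \<comment> \<open>The first entry settles n = 0 and keeps C positive; the second gives a C^(p-1)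
    \<ge> 2 s exp(s), where the factor 2 pays for 1/N \<le> 2/(N+1).\<close>
  define C where "C = max (t 0 + 1) ((2 * s * exp s / a) powr s)"
  have C: "0 < C" "t 0 \<le> C" using nonneg[of 0] unfolding C_def by (auto intro: add_nonneg_pos simp: less_max_iff_disj)
  have "2 * s * exp s / a = ((2 * s * exp s / a) powr s) powr (p - 1)"
    using s a by (simp add: powr_powr)
  also have "\<dots> \<le> C powr (p - 1)" using p by (intro powr_mono2) (auto simp: C_def)
  finally have Cp: "2 * s * exp s \<le> a * C powr (p - 1)" using a by (simp add: field_simps)
  have "t n \<le> C * real (Suc n) powr (- s)" for n
  proof (induction n)
    case 0
    then show ?case using C by simp
  next
    case (Suc n)
    define N where "N = real (Suc n)"
    have N: "1 \<le> N" "real (Suc (Suc n)) = N + 1" by (auto simp: N_def)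
    define b where "b = C * (N + 1) powr (- s)"
    have b: "0 < b" using C N by (simp add: b_def)
    show ?case
    proof (rule ccontr)
      assume "\<not> ?thesis"
      then have "b < t (Suc n)" unfolding N(2) b_def by simp
      moreover then have "b powr p \<le> t (Suc n) powr p" using b p by (intro powr_mono2) auto
      ultimately have "b + a * b powr p < t (Suc n) + a * t (Suc n) powr p"
        using a by (simp add: add_less_le_mono)
      also have "\<dots> \<le> C * N powr (- s)" using step[of n] Suc by (simp add: N_def)
      finally have lt: "b + a * b powr p < C * N powr (- s)" .
      \<comment> \<open>Because s p = s + 1, the power b^p is b times C^(p-1)/(N+1), so both sides
        of \<open>lt\<close> can be compared after division by b.\<close>
      have "b powr p = C powr p * (N + 1) powr (- (s + 1))"
        using C N s by (simp add: b_def powr_mult powr_powr)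
      also have "C powr p = C * C powr (p - 1)"
        using C by (simp add: powr_mult_base)
      also have "(N + 1) powr (- (s + 1)) = (N + 1) powr (- s) / (N + 1)"
        using N by (simp add: powr_diff powr_minus_divide)
      finally have bp: "b powr p = b * (C powr (p - 1) / (N + 1))" by (simp add: b_def)
      have "C * N powr (- s) = b * (1 + 1 / N) powr s"
      proof -
        have "1 + 1 / N = (N + 1) / N" using N by (simp add: field_simps)
        then have "(1 + 1 / N) powr s = (N + 1) powr s / N powr s"
          using N by (simp add: powr_divide)
        then show ?thesis using N by (simp add: b_def powr_minus_divide)
      qed
      also have "\<dots> \<le> b * (1 + s * exp s * (1 / N))"
        using one_plus_powr_le[of "1 / N" s] N s b by (intro mult_left_mono) auto
      also have "\<dots> \<le> b * (1 + a * C powr (p - 1) / (N + 1))"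
      proof -
        have "s * exp s * (1 / N) \<le> s * exp s * (2 / (N + 1))"
          using N s by (intro mult_left_mono) (auto simp: field_simps)
        also have "\<dots> \<le> a * C powr (p - 1) / (N + 1)"
          using divide_right_mono[OF Cp, of "N + 1"] N by (simp add: mult_ac)
        finally show ?thesis using b by (intro mult_left_mono add_left_mono) auto
      qed
      also have "\<dots> = b + a * b powr p" by (simp add: bp algebra_simps)
      finally show False using lt by simp
    qed
  qed
  then show ?thesis using C that unfolding s_def by blast
qed

section \<open>Gradients and subdifferentials\<close>

lemma gradient_eqI:
  assumes "GDERIV h x :> D"
  shows "gradient h x = D"
  unfolding gradient_def
proof (rule the_equality)
  fix E assume E: "GDERIV h x :> E"
  from E assms have "(\<lambda>k. k \<bullet> E) = (\<lambda>k. k \<bullet> D)"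
    unfolding gderiv_def by (rule has_derivative_unique)
  then have "(E - D) \<bullet> E = (E - D) \<bullet> D" by (rule fun_cong)
  then have "(E - D) \<bullet> (E - D) = 0" by (simp add: inner_diff_right)
  then show "E = D" by simp
qed (fact assms)

text \<open>The vector representing the derivative D as an inner product is the adjoint of D applied
  to 1.\<close>

lemma differentiable_imp_GDERIV:
  fixes h :: "'a::euclidean_space \<Rightarrow> real"
  assumes "h differentiable at x"
  shows "GDERIV h x :> gradient h x"
proof -
  obtain D where D: "(h has_derivative D) (at x)"
    using assms by (auto simp: differentiable_def)
  then have "linear D" by (rule has_derivative_linear)
  then have "D = (\<lambda>k. k \<bullet> adjoint D 1)" by (simp add: adjoint_works)
  with D have "GDERIV h x :> adjoint D 1" by (simp add: gderiv_def)
  then show ?thesis by (simp add: gradient_eqI)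
qed

text \<open>This and the next lemma turn the partial gradients of the algorithm into blocks of one
  gradient on the product space, whose continuity \<open>smooth_fun\<close> provides.\<close>

lemma gradient_x_eq_fst:
  fixes H :: "'a::euclidean_space \<times> 'b::euclidean_space \<Rightarrow> real"
  assumes "smooth_fun H"
  shows "gradient_x H x y = fst (gradient H (x, y))"
  unfolding gradient_x_def
proof (rule gradient_eqI)
  have "(H has_derivative (\<lambda>k. k \<bullet> gradient H (x, y))) (at (x, y))"
    using assms differentiable_imp_GDERIV by (auto simp: smooth_fun_def gderiv_def)
  moreover have "((\<lambda>x'. (x', y)) has_derivative (\<lambda>k. (k, 0))) (at x)"
    by (auto intro!: derivative_eq_intros)
  ultimately have "((\<lambda>x'. H (x', y)) has_derivative (\<lambda>k. (k, 0) \<bullet> gradient H (x, y))) (at x)"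
    using has_derivative_compose by fastforce
  then show "GDERIV (\<lambda>x'. H (x', y)) x :> fst (gradient H (x, y))"
    by (simp add: gderiv_def inner_prod_def)
qed

lemma gradient_y_eq_snd:
  fixes H :: "'a::euclidean_space \<times> 'b::euclidean_space \<Rightarrow> real"
  assumes "smooth_fun H"
  shows "gradient_y H x y = snd (gradient H (x, y))"
  unfolding gradient_y_def
proof (rule gradient_eqI)
  have "(H has_derivative (\<lambda>k. k \<bullet> gradient H (x, y))) (at (x, y))"
    using assms differentiable_imp_GDERIV by (auto simp: smooth_fun_def gderiv_def)
  moreover have "((\<lambda>y'. (x, y')) has_derivative (\<lambda>k. (0, k))) (at y)"
    by (auto intro!: derivative_eq_intros)
  ultimately have "((\<lambda>y'. H (x, y')) has_derivative (\<lambda>k. (0, k) \<bullet> gradient H (x, y))) (at y)"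
    using has_derivative_compose by fastforce
  then show "GDERIV (\<lambda>y'. H (x, y')) y :> snd (gradient H (x, y))"
    by (simp add: gderiv_def inner_prod_def)
qed

lemma smooth_fun_gradient_bounded:
  fixes H :: "'a::euclidean_space \<Rightarrow> real"
  assumes "smooth_fun H" "bounded S"
  obtains G where "0 \<le> G" "\<And>z. z \<in> S \<Longrightarrow> norm (gradient H z) \<le> G"
proof -
  have "compact (gradient H ` closure S)"
    using assms unfolding smooth_fun_def
    by (intro compact_continuous_image) (auto intro: continuous_on_subset)
  then obtain G where G: "\<forall>v\<in>gradient H ` closure S. norm v \<le> G"
    using compact_imp_bounded bounded_iff by metis
  \<comment> \<open>For empty \<open>S\<close> the bound \<open>G\<close> could be negative, hence
    the maximum with 0.\<close>
  have "norm (gradient H z) \<le> max G 0" if "z \<in> S" for z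
    using G closure_subset[of S] that by (auto simp: le_max_iff_disj)
  then show ?thesis using that[of "max G 0"] by simp
qed

text \<open>The mean value inequality asks for a convex domain, so \<open>S\<close> is first
  enlarged to a ball.\<close>

lemma smooth_fun_lipschitz_on_bounded:
  fixes H :: "'a::euclidean_space \<Rightarrow> real"
  assumes H: "smooth_fun H" and "bounded S"
  obtains G where "0 \<le> G" "\<And>z z'. z \<in> S \<Longrightarrow> z' \<in> S \<Longrightarrow> \<bar>H z - H z'\<bar> \<le> G * norm (z - z')"
proof -
  obtain r where r: "S \<subseteq> cball 0 r"
    using \<open>bounded S\<close> bounded_subset_ballD[of S 0] ball_subset_cball by (meson order_trans)
  obtain G where G: "0 \<le> G" "\<And>z. z \<in> cball 0 r \<Longrightarrow> norm (gradient H z) \<le> G"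
    using smooth_fun_gradient_bounded[OF H bounded_cball] by metis
  have "\<bar>H z - H z'\<bar> \<le> G * norm (z - z')" if "z \<in> S" "z' \<in> S" for z z'
  proof -
    have "norm (H z - H z') \<le> G * norm (z - z')"
    proof (rule differentiable_bound[of "cball 0 r" H "\<lambda>z k. k \<bullet> gradient H z" G z z'])
      fix w :: 'a assume w: "w \<in> cball 0 r"
      show "(H has_derivative (\<lambda>k. k \<bullet> gradient H w)) (at w within cball 0 r)"
        using H differentiable_imp_GDERIV
        by (auto simp: smooth_fun_def gderiv_def intro: has_derivative_at_withinI)
      show "onorm (\<lambda>k. k \<bullet> gradient H w) \<le> G"
      proof (rule onorm_le)
        fix k :: 'a
        have "\<bar>k \<bullet> gradient H w\<bar> \<le> norm k * norm (gradient H w)" by (rule Cauchy_Schwarz_ineq2)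
        also have "\<dots> \<le> norm k * G" using G(2)[OF w] by (intro mult_left_mono) auto
        finally show "norm (k \<bullet> gradient H w) \<le> G * norm k" by (simp add: mult.commute)
      qed
    qed (use r that in auto)
    then show ?thesis by simp
  qed
  then show ?thesis by (rule that[OF G(1)])
qed

section \<open>Lower semicontinuity, subgradients and the KL inequality\<close>

lemma lsc_fun_le_of_tendsto:
  fixes h :: "'a::metric_space \<Rightarrow> ereal"
  assumes h: "lsc_fun h" and X: "X \<longlonglongrightarrow> x" and hX: "(\<lambda>n. h (X n)) \<longlonglongrightarrow> l"
  shows "h x \<le> l"
proof (rule ccontr)
  assume "\<not> h x \<le> l"
  then obtain c where c: "l < c" "c < h x" using dense[of l "h x"] by (auto simp: not_le)
  then have "c < Liminf (at x) h" using h unfolding lsc_fun_def by (meson order.strict_trans2)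
  then have "\<forall>\<^sub>F z in at x. c < h z" by (rule less_LiminfD)
  \<comment> \<open>\<open>lsc_fun\<close> uses a punctured limit. Since c < h x holds as well, the
    point itself may be included, so the sequence is allowed to hit x.\<close>
  then have "\<forall>\<^sub>F z in nhds x. c < h z"
    using c by (simp add: eventually_nhds_conv_at)
  then have "\<forall>\<^sub>F n in sequentially. c < h (X n)"
    using X by (rule eventually_compose_filterlim)
  then have "c \<le> l"
    by (intro tendsto_lowerbound[OF hX]) (auto elim: eventually_mono)
  then show False using c by simp
qed

text \<open>A Liminf is at least 0 iff the quotient eventually exceeds every negative c. Placing a
  real -\<epsilon> between c and 0 makes this a real inequality; at points where h is infinite the
  quotient is infinite and nothing is to be shown.\<close>

lemma frechet_subdiffI:
  fixes h :: "'a::real_inner \<Rightarrow> ereal"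
  assumes hx: "h x = ereal r" and proper: "\<And>z. h z \<noteq> -\<infinity>"
    and lower: "\<And>\<epsilon>. 0 < \<epsilon> \<Longrightarrow> \<forall>\<^sub>F z in at x. \<forall>s. h z = ereal s \<longrightarrow>
        r + v \<bullet> (z - x) - \<epsilon> * norm (z - x) \<le> s"
  shows "v \<in> frechet_subdiff h x"
proof -
  have "\<forall>\<^sub>F z in at x. c < (h z - h x - ereal (v \<bullet> (z - x))) / ereal (norm (z - x))"
    if c: "c < 0" for c :: ereal
  proof -
    obtain \<epsilon> where \<epsilon>: "0 < \<epsilon>" "c < ereal (- \<epsilon>)"
    proof -
      obtain q where "c < ereal q" "ereal q < 0" using ereal_dense2[OF c] by auto
      then show ?thesis using that[of "- q"] by simp
    qed
    show ?thesis
      using lower[OF \<epsilon>(1)] eventually_neq_at_within[of x x UNIV]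
    proof eventually_elim
      case (elim z)
      then have nz: "0 < norm (z - x)" by simp
      show ?case
      proof (cases "h z")
        case (real s)
        have "r + v \<bullet> (z - x) - \<epsilon> * norm (z - x) \<le> s" using elim real by blast
        then have "- \<epsilon> \<le> (s - r - v \<bullet> (z - x)) / norm (z - x)"
          using nz by (simp add: field_simps)
        with \<epsilon>(2) have "c < ereal ((s - r - v \<bullet> (z - x)) / norm (z - x))"
          by (auto elim: order.strict_trans2)
        then show ?thesis using nz by (simp add: real hx)
      next
        case PInf
        then show ?thesis using nz c by (auto simp: hx)
      next
        case MInf
        then show ?thesis using proper by simp
      qed
    qed
  qed
  then have "0 \<le> Liminf (at x) (\<lambda>z. (h z - h x - ereal (v \<bullet> (z - x))) / ereal (norm (z - x)))"
    unfolding le_Liminf_iff by blast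
  then show ?thesis unfolding frechet_subdiff_def by (simp add: hx)
qed

lemma frechet_subset_limiting_subdiff: "frechet_subdiff h x \<subseteq> limiting_subdiff h x"
proof
  fix v assume v: "v \<in> frechet_subdiff h x"
  then have "\<bar>h x\<bar> \<noteq> \<infinity>" by (simp add: frechet_subdiff_def)
  with v show "v \<in> limiting_subdiff h x"
    unfolding limiting_subdiff_def
    by (intro CollectI conjI exI[of _ "\<lambda>_. x"] exI[of _ "\<lambda>_. v"]) auto
qed

text \<open>The derivative of c t^(1-\<theta>) is c (1-\<theta>) t^(-\<theta>), and the distance
  from 0 to the subdifferential is at most the norm of any subgradient. Clearing the negative power
  leaves an inequality between reals.\<close>

lemma KL_exponent_inequality:
  fixes h :: "'a::real_inner \<Rightarrow> ereal"
  assumes KL: "KL_exponent h \<theta>" and sub: "limiting_subdiff h xb \<noteq> {}" and hxb: "h xb = ereal \<omega>"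
  obtains c \<epsilon> U where "0 < c" "0 < \<epsilon>" "open U" "xb \<in> U"
    "\<And>x s v. x \<in> U \<Longrightarrow> h x = ereal s \<Longrightarrow> \<omega> < s \<Longrightarrow> s < \<omega> + \<epsilon> \<Longrightarrow> v \<in> limiting_subdiff h x
      \<Longrightarrow> (s - \<omega>) powr \<theta> \<le> c * norm v"
proof -
  have \<theta>: "\<theta> < 1" using KL by (simp add: KL_exponent_def)
  obtain c :: real and \<epsilon>' :: ereal and U where U: "0 < c" "0 < \<epsilon>'" "open U" "xb \<in> U"
    and ineq: "\<forall>x\<in>U. h xb < h x \<and> h x < h xb + \<epsilon>' \<longrightarrow>
            1 \<le> ereal (deriv (\<lambda>t. c * t powr (1 - \<theta>)) (real_of_ereal (h x - h xb)))
                 * edist_set 0 (limiting_subdiff h x)"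
    using KL sub unfolding KL_exponent_def by blast
  \<comment> \<open>The range in the KL property may be infinite; a smaller real one is
    chosen.\<close>
  obtain \<epsilon> where \<epsilon>: "0 < \<epsilon>" "ereal \<epsilon> < \<epsilon>'"
    using ereal_dense2[OF U(2)] by auto
  have main: "(s - \<omega>) powr \<theta> \<le> (c * (1 - \<theta>)) * norm v"
    if x: "x \<in> U" and s: "h x = ereal s" "\<omega> < s" "s < \<omega> + \<epsilon>" and v: "v \<in> limiting_subdiff h x"
    for x s v
  proof -
    have "ereal s < ereal \<omega> + \<epsilon>'"
    proof -
      have "ereal s < ereal \<omega> + ereal \<epsilon>" using s by simp
      also have "\<dots> \<le> ereal \<omega> + \<epsilon>'" using \<epsilon> by (intro add_left_mono) auto
      finally show ?thesis .
    qed
    then have "1 \<le> ereal (deriv (\<lambda>t. c * t powr (1 - \<theta>)) (s - \<omega>)) * edist_set 0 (limiting_subdiff h x)"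
      using ineq[rule_format, of x] x s hxb by simp
    moreover have "((\<lambda>t. t powr (1 - \<theta>)) has_real_derivative (1 - \<theta>) * (s - \<omega>) powr (1 - \<theta> - 1)) (at (s - \<omega>))"
      using s by (intro has_real_derivative_powr) simp
    then have "((\<lambda>t. c * t powr (1 - \<theta>)) has_real_derivative c * ((1 - \<theta>) * (s - \<omega>) powr (1 - \<theta> - 1))) (at (s - \<omega>))"
      by (rule DERIV_cmult)
    then have "deriv (\<lambda>t. c * t powr (1 - \<theta>)) (s - \<omega>) = c * (1 - \<theta>) * (s - \<omega>) powr - \<theta>"
      by (simp add: DERIV_imp_deriv)
    ultimately have "1 \<le> ereal (c * (1 - \<theta>) * (s - \<omega>) powr - \<theta>) * edist_set 0 (limiting_subdiff h x)"
      by (simp only:)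
    also have "ereal (c * (1 - \<theta>) * (s - \<omega>) powr - \<theta>) * edist_set 0 (limiting_subdiff h x)
        \<le> ereal (c * (1 - \<theta>) * (s - \<omega>) powr - \<theta>) * ereal (norm v)"
    proof (rule ereal_mult_left_mono)
      show "edist_set 0 (limiting_subdiff h x) \<le> ereal (norm v)"
        unfolding edist_set_def using v by (rule INF_lower2) simp
    qed (use U(1) \<theta> in auto)
    finally have "1 \<le> c * (1 - \<theta>) * (s - \<omega>) powr - \<theta> * norm v" by simp
    then show ?thesis using s by (simp add: powr_minus field_simps)
  qed
  show ?thesis
    by (rule that[of "c * (1 - \<theta>)" \<epsilon> U]) (use U \<epsilon> \<theta> main in auto)
qed

section \<open>Proximal descent under the Kurdyka-Lojasiewicz inequality\<close>

text \<open>The block structure is forgotten here: \<open>F\<close> stands for f + g on the product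
  space, \<open>w\<close> for the iterates, \<open>\<phi>\<close> for the values of \<open>F\<close>
  along them, \<open>p\<close> for the vectors produced by the prox steps, \<open>u\<close> for the
  merit values and \<open>d\<close> for the lengths of the lifted steps $z^k - z^{k-1}$. The
  properties of \<open>p\<close> start at index 1 because \<open>w 0\<close> is not the result of a
  prox step.\<close>

locale prox_descent =
  fixes F :: "'e::euclidean_space \<Rightarrow> ereal" and H :: "'e \<Rightarrow> real"
    and w p :: "nat \<Rightarrow> 'e" and \<phi> u d :: "nat \<Rightarrow> real"
    and \<kappa> C \<sigma> a b :: real and m :: nat
  assumes H: "smooth_fun H"
    and F_proper: "\<And>z. F z \<noteq> -\<infinity>"
    and F_w: "\<And>k. F (w k) = ereal (\<phi> k)"
    and lsc: "lsc_fun (\<lambda>z. F z + ereal (H z))"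
    and bounded: "bounded (range w)"
    and prox_le: "\<And>k z s. F z = ereal s \<Longrightarrow>
        \<phi> (Suc k) + p (Suc k) \<bullet> (z - w (Suc k)) - \<kappa> * (norm (z - w (Suc k)))\<^sup>2 \<le> s"
    and residual: "\<And>k. norm (p (Suc k) + gradient H (w (Suc k))) \<le> C * d (Suc k)"
    and step_le: "\<And>k. norm (w (Suc k) - w k) \<le> d (Suc k)"
    and u_ge: "\<And>k. \<phi> k + H (w k) \<le> u k"
    and u_le: "\<And>k. u k \<le> \<phi> k + H (w k) + \<sigma> * (d k)\<^sup>2"
    and descent: "\<And>k. u (Suc k) \<le> window_max m u k - a * (d (Suc k))\<^sup>2"
    and below: "\<And>k. b \<le> u k"
    and constants: "0 \<le> \<kappa>" "0 \<le> C" "0 \<le> \<sigma>" "0 < a"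
begin

lemma d_nonneg: "0 \<le> d (Suc k)"
  using norm_ge_zero step_le by (rule order_trans)

lemma u_decseq: "decseq (window_max m u)"
proof (rule decseq_window_max)
  fix k
  have "0 \<le> a * (d (Suc k))\<^sup>2" using constants by simp
  then show "u (Suc k) \<le> window_max m u k" using descent[of k] by linarith
qed

text \<open>By \<open>descent\<close>, a times a squared step is at most the initial window maximum
  minus the lower bound b. This lets quadratic terms in the step be replaced by linear ones.\<close>

lemma d_bounded:
  obtains D where "0 \<le> D" "\<And>k. d (Suc k) \<le> D"
proof -
  have "d (Suc k) \<le> sqrt ((window_max m u 0 - b) / a)" for k
  proof (rule real_le_rsqrt)
    have "window_max m u k \<le> window_max m u 0" using u_decseq by (simp add: decseqD)
    then have "a * (d (Suc k))\<^sup>2 \<le> window_max m u 0 - b"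
      using descent[of k] below[of "Suc k"] by linarith
    then show "(d (Suc k))\<^sup>2 \<le> (window_max m u 0 - b) / a"
      using constants by (simp add: field_simps)
  qed
  then show ?thesis using that d_nonneg[of 0] by (meson order_trans)
qed

text \<open>The values of \<open>u\<close> may increase, but only by a multiple of the step length: this replaces the
  uniform continuity of the objective that nonmonotone line search arguments usually need.\<close>

lemma u_step_le:
  obtains K where "\<And>k. u (Suc k) \<le> u k + K * d (Suc k)"
proof -
  obtain D where D: "0 \<le> D" "\<And>k. d (Suc k) \<le> D" using d_bounded by metis
  obtain G where G: "0 \<le> G" "\<And>k. norm (gradient H (w k)) \<le> G"
    using smooth_fun_gradient_bounded[OF H bounded] by (metis rangeI)
  obtain G' where G': "\<And>k j. \<bar>H (w k) - H (w j)\<bar> \<le> G' * norm (w k - w j)" and G'0: "0 \<le> G'"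
    using smooth_fun_lipschitz_on_bounded[OF H bounded] by (metis rangeI)
  \<comment> \<open>C D + G bounds the norm of p; \<kappa> D and \<sigma> D come from the two
    quadratic terms via \<open>d_bounded\<close>; G' is a Lipschitz constant of H along the
    iterates.\<close>
  have "u (Suc k) \<le> u k + (C * D + G + \<kappa> * D + G' + \<sigma> * D) * d (Suc k)" for k
  proof -
    let ?d = "d (Suc k)"
    have dd: "?d\<^sup>2 \<le> D * ?d" "(norm (w k - w (Suc k)))\<^sup>2 \<le> D * ?d" "norm (w k - w (Suc k)) \<le> ?d"
    proof -
      show "?d\<^sup>2 \<le> D * ?d"
        unfolding power2_eq_square using D d_nonneg by (intro mult_right_mono) auto
      show n: "norm (w k - w (Suc k)) \<le> ?d" using step_le[of k] by (simp add: norm_minus_commute)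
      then have "(norm (w k - w (Suc k)))\<^sup>2 \<le> ?d\<^sup>2" by (rule power_mono) simp
      then show "(norm (w k - w (Suc k)))\<^sup>2 \<le> D * ?d" using \<open>?d\<^sup>2 \<le> D * ?d\<close> by simp
    qed
    have "norm (p (Suc k)) \<le> norm (p (Suc k) + gradient H (w (Suc k))) + norm (gradient H (w (Suc k)))"
      using norm_triangle_ineq4[of "p (Suc k) + gradient H (w (Suc k))" "gradient H (w (Suc k))"] by simp
    also have "\<dots> \<le> C * D + G"
      using residual[of k] mult_left_mono[OF D(2)[of k] constants(2)] G(2)[of "Suc k"] by linarith
    finally have p: "norm (p (Suc k)) \<le> C * D + G" .
    have "- (p (Suc k) \<bullet> (w k - w (Suc k))) \<le> norm (p (Suc k)) * norm (w k - w (Suc k))"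
      using Cauchy_Schwarz_ineq2[of "p (Suc k)" "w k - w (Suc k)"] by linarith
    also have "\<dots> \<le> (C * D + G) * ?d"
      using p dd(3) D G constants by (intro mult_mono) auto
    finally have 1: "- (p (Suc k) \<bullet> (w k - w (Suc k))) \<le> (C * D + G) * ?d" .
    have 2: "\<kappa> * (norm (w k - w (Suc k)))\<^sup>2 \<le> \<kappa> * (D * ?d)" "\<sigma> * ?d\<^sup>2 \<le> \<sigma> * (D * ?d)"
      using dd constants by (auto intro!: mult_left_mono)
    have 3: "H (w (Suc k)) - H (w k) \<le> G' * ?d"
      using G'[of "Suc k" k] mult_left_mono[OF step_le[of k] G'0] by linarith
    \<comment> \<open>Testing \<open>prox_le\<close> at z = w k compares the new value of
      \<open>F\<close> with the old one.\<close>
    show ?thesis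
      using 1 2 3 prox_le[OF F_w[of k], of k] u_le[of "Suc k"] u_ge[of k]
      by (simp add: algebra_simps)
  qed
  then show ?thesis by (rule that)
qed

text \<open>The objective differs from \<open>u\<close> by at most \<sigma> d^2, so it inherits the
  limit of \<open>u\<close> once the steps vanish.\<close>

lemma convergence:
  obtains \<omega> where "u \<longlonglongrightarrow> \<omega>" "d \<longlonglongrightarrow> 0" "\<And>k. \<omega> \<le> window_max m u k"
    "(\<lambda>k. \<phi> k + H (w k)) \<longlonglongrightarrow> \<omega>"
proof -
  obtain K where K: "\<And>k. u (Suc k) \<le> u k + K * d (Suc k)" using u_step_le by metis
  obtain \<omega> where \<omega>: "u \<longlonglongrightarrow> \<omega>" "d \<longlonglongrightarrow> 0" "\<And>k. \<omega> \<le> window_max m u k"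
    using nonmonotone_descent_tendsto[OF constants(4) descent K below] by metis
  have "(\<lambda>k. u k - \<sigma> * (d k)\<^sup>2) \<longlonglongrightarrow> \<omega> - \<sigma> * 0\<^sup>2" by (intro tendsto_intros \<omega>)
  then have low: "(\<lambda>k. u k - \<sigma> * (d k)\<^sup>2) \<longlonglongrightarrow> \<omega>" by simp
  have "(\<lambda>k. \<phi> k + H (w k)) \<longlonglongrightarrow> \<omega>"
  proof (rule tendsto_sandwich[OF _ _ low \<omega>(1)])
    show "\<forall>\<^sub>F k in sequentially. u k - \<sigma> * (d k)\<^sup>2 \<le> \<phi> k + H (w k)"
      using u_le by (intro always_eventually allI) (simp add: algebra_simps)
    show "\<forall>\<^sub>F k in sequentially. \<phi> k + H (w k) \<le> u k"
      using u_ge by (intro always_eventually allI)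
  qed
  then show ?thesis by (rule that[OF \<omega>])
qed

text \<open>The quadratic term in \<open>prox_le\<close> is o of the distance, so p is a Frechet
  subgradient of \<open>F\<close>; differentiability of H adds its gradient. Each of the two errors
  receives \<epsilon>/2.\<close>

lemma frechet_subdiff_iterate:
  "p (Suc k) + gradient H (w (Suc k)) \<in> frechet_subdiff (\<lambda>z. F z + ereal (H z)) (w (Suc k))"
proof (rule frechet_subdiffI)
  let ?w = "w (Suc k)"
  show "F ?w + ereal (H ?w) = ereal (\<phi> (Suc k) + H ?w)" by (simp add: F_w)
  show "F z + ereal (H z) \<noteq> -\<infinity>" for z using F_proper[of z] by (cases "F z") auto
  fix \<epsilon> :: real assume \<epsilon>: "0 < \<epsilon>"
  have "(H has_derivative (\<lambda>k. k \<bullet> gradient H ?w)) (at ?w)"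
    using H differentiable_imp_GDERIV by (auto simp: smooth_fun_def gderiv_def)
  then have "\<forall>\<^sub>F z in at ?w. norm (H z - H ?w - (z - ?w) \<bullet> gradient H ?w) \<le> (\<epsilon> / 2) * norm (z - ?w)"
    using \<epsilon> unfolding has_derivative_within_alt2
    by (elim conjE allE[of _ "\<epsilon> / 2"]) simp
  moreover have "\<forall>\<^sub>F z in at ?w. \<kappa> * norm (z - ?w) < \<epsilon> / 2"
  proof (rule order_tendstoD)
    have "((\<lambda>z. \<kappa> * norm (z - ?w)) \<longlongrightarrow> \<kappa> * norm (?w - ?w)) (at ?w)"
      by (intro tendsto_intros)
    then show "((\<lambda>z. \<kappa> * norm (z - ?w)) \<longlongrightarrow> 0) (at ?w)" by simp
  qed (use \<epsilon> in simp)
  ultimately show "\<forall>\<^sub>F z in at ?w. \<forall>s. F z + ereal (H z) = ereal s \<longrightarrow>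
      \<phi> (Suc k) + H ?w + (p (Suc k) + gradient H ?w) \<bullet> (z - ?w) - \<epsilon> * norm (z - ?w) \<le> s"
  proof eventually_elim
    case (elim z)
    show ?case
    proof (intro allI impI)
      fix s assume s: "F z + ereal (H z) = ereal s"
      then have "F z = ereal (s - H z)" by (cases "F z") auto
      note prox_le[OF this, of k]
      moreover have "\<kappa> * (norm (z - ?w))\<^sup>2 \<le> \<epsilon> / 2 * norm (z - ?w)"
        using mult_right_mono[OF less_imp_le[OF elim(2)] norm_ge_zero[of "z - ?w"]]
        by (simp add: power2_eq_square mult_ac)
      moreover have "H ?w + (z - ?w) \<bullet> gradient H ?w - H z \<le> \<epsilon> / 2 * norm (z - ?w)"
        using elim(1) unfolding real_norm_def by linarith
      ultimately show "\<phi> (Suc k) + H ?w + (p (Suc k) + gradient H ?w) \<bullet> (z - ?w) - \<epsilon> * norm (z - ?w) \<le> s"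
        by (simp add: algebra_simps inner_commute)
    qed
  qed
qed

text \<open>Lower semicontinuity only gives that the value at z is at most \<omega>. The reverse
  inequality is \<open>prox_le\<close> tested at z itself, passed to the limit along the
  subsequence.\<close>

lemma cluster_point:
  assumes \<omega>: "(\<lambda>k. \<phi> k + H (w k)) \<longlonglongrightarrow> \<omega>" and d: "d \<longlonglongrightarrow> 0"
    and r: "filterlim r sequentially sequentially" and w: "(\<lambda>n. w (Suc (r n))) \<longlonglongrightarrow> z"
  shows "F z + ereal (H z) = ereal \<omega>" "limiting_subdiff (\<lambda>z. F z + ereal (H z)) z \<noteq> {}"
proof -
  have r': "filterlim (\<lambda>n. Suc (r n)) sequentially sequentially"
    using filterlim_compose[OF filterlim_Suc r] .
  have val: "(\<lambda>n. \<phi> (Suc (r n)) + H (w (Suc (r n)))) \<longlonglongrightarrow> \<omega>"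
    by (rule filterlim_compose[OF \<omega> r'])
  then have val': "(\<lambda>n. F (w (Suc (r n))) + ereal (H (w (Suc (r n))))) \<longlonglongrightarrow> ereal \<omega>"
    by (simp add: F_w)
  have le: "F z + ereal (H z) \<le> ereal \<omega>"
    using lsc w val' by (rule lsc_fun_le_of_tendsto)
  then obtain s where s: "F z = ereal s" using F_proper[of z] by (cases "F z") auto
  have Hc: "continuous_on UNIV H"
    using H by (auto simp: smooth_fun_def intro!: continuous_at_imp_continuous_on differentiable_imp_continuous_within)
  have H_lim: "(\<lambda>n. H (w (Suc (r n)))) \<longlonglongrightarrow> H z"
    using continuous_on_tendsto_compose[OF Hc w] by simp
  have g_lim: "(\<lambda>n. gradient H (w (Suc (r n)))) \<longlonglongrightarrow> gradient H z"
    using continuous_on_tendsto_compose[of UNIV "gradient H", OF _ w] H by (simp add: smooth_fun_def)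
  have res_lim: "(\<lambda>n. p (Suc (r n)) + gradient H (w (Suc (r n)))) \<longlonglongrightarrow> 0"
  proof (rule Lim_null_comparison)
    show "\<forall>\<^sub>F n in sequentially. norm (p (Suc (r n)) + gradient H (w (Suc (r n)))) \<le> C * d (Suc (r n))"
      using residual by (intro always_eventually allI)
    have "(\<lambda>n. C * d (Suc (r n))) \<longlonglongrightarrow> C * 0"
      by (intro tendsto_intros filterlim_compose[OF d r'])
    then show "(\<lambda>n. C * d (Suc (r n))) \<longlonglongrightarrow> 0" by simp
  qed
  have p_lim: "(\<lambda>n. p (Suc (r n))) \<longlonglongrightarrow> - gradient H z"
    using tendsto_diff[OF res_lim g_lim] by simp
  have \<phi>_lim: "(\<lambda>n. \<phi> (Suc (r n))) \<longlonglongrightarrow> \<omega> - H z"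
    using tendsto_diff[OF val H_lim] by simp
  have "(\<lambda>n. \<phi> (Suc (r n)) + p (Suc (r n)) \<bullet> (z - w (Suc (r n))) - \<kappa> * (norm (z - w (Suc (r n))))\<^sup>2)
      \<longlonglongrightarrow> \<omega> - H z + (- gradient H z) \<bullet> (z - z) - \<kappa> * (norm (z - z))\<^sup>2"
    by (intro tendsto_intros \<phi>_lim p_lim w)
  then have "\<omega> - H z + (- gradient H z) \<bullet> (z - z) - \<kappa> * (norm (z - z))\<^sup>2 \<le> s"
    by (rule LIMSEQ_le_const2) (use prox_le[OF s] in auto)
  then show eq: "F z + ereal (H z) = ereal \<omega>" using le s by simp
  \<comment> \<open>The subgradients of \<open>frechet_subdiff_iterate\<close> tend to 0 by
    \<open>residual\<close>, and the values converge to the value at z by \<open>eq\<close>, as the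
    limiting subdifferential demands.\<close>
  have "0 \<in> limiting_subdiff (\<lambda>z. F z + ereal (H z)) z"
    unfolding limiting_subdiff_def
  proof (intro CollectI conjI exI allI)
    show "\<bar>F z + ereal (H z)\<bar> \<noteq> \<infinity>" by (simp add: eq)
    show "(\<lambda>n. F (w (Suc (r n))) + ereal (H (w (Suc (r n))))) \<longlonglongrightarrow> F z + ereal (H z)"
      using val' eq by simp
  qed (fact w frechet_subdiff_iterate res_lim)+
  then show "limiting_subdiff (\<lambda>z. F z + ereal (H z)) z \<noteq> {}" by blast
qed

text \<open>The KL constants depend on the base point; compactness makes them uniform. If no pair A,
  N worked, the failures for A = n + 1 would have a cluster point, where the KL inequality and
  \<open>residual\<close> give the estimate with one fixed constant.\<close>

lemma KL_along_iterates:
  assumes KL: "KL_exponent (\<lambda>z. F z + ereal (H z)) \<theta>"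
    and \<omega>: "(\<lambda>k. \<phi> k + H (w k)) \<longlonglongrightarrow> \<omega>" and d: "d \<longlonglongrightarrow> 0"
  obtains A N where "0 < A"
    "\<And>k. N \<le> k \<Longrightarrow> \<omega> < \<phi> (Suc k) + H (w (Suc k)) \<Longrightarrow>
      (\<phi> (Suc k) + H (w (Suc k)) - \<omega>) powr \<theta> \<le> A * d (Suc k)"
proof -
  let ?\<psi> = "\<lambda>k. \<phi> (Suc k) + H (w (Suc k))"
  have "\<exists>A N. 0 < A \<and> (\<forall>k\<ge>N. \<omega> < ?\<psi> k \<longrightarrow> (?\<psi> k - \<omega>) powr \<theta> \<le> A * d (Suc k))"
  proof (rule ccontr)
    assume contra: "\<not> ?thesis"
    have "\<forall>n. \<exists>k\<ge>n. \<omega> < ?\<psi> k \<and> real (Suc n) * d (Suc k) < (?\<psi> k - \<omega>) powr \<theta>"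
    proof
      fix n
      have "0 < real (Suc n)" by simp
      with contra show "\<exists>k\<ge>n. \<omega> < ?\<psi> k \<and> real (Suc n) * d (Suc k) < (?\<psi> k - \<omega>) powr \<theta>"
        by (meson not_le)
    qed
    then obtain q where q: "\<And>n. n \<le> q n" "\<And>n. \<omega> < ?\<psi> (q n)"
      "\<And>n. real (Suc n) * d (Suc (q n)) < (?\<psi> (q n) - \<omega>) powr \<theta>" by metis
    have "seq_compact (closure (range w))"
      using bounded by (simp add: compact_imp_seq_compact compact_closure)
    moreover have "\<forall>n. w (Suc (q n)) \<in> closure (range w)" using closure_subset by fast
    ultimately obtain z t where t: "strict_mono t" "((\<lambda>n. w (Suc (q n))) \<circ> t) \<longlonglongrightarrow> z"
      by (rule seq_compactE)
    have qt: "filterlim (\<lambda>n. q (t n)) sequentially sequentially"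
    proof (rule filterlim_at_top_mono[OF filterlim_ident])
      show "\<forall>\<^sub>F n in sequentially. n \<le> q (t n)"
        using q(1) seq_suble[OF t(1)] by (intro always_eventually allI) (meson order_trans)
    qed
    have w: "(\<lambda>n. w (Suc (q (t n)))) \<longlonglongrightarrow> z" using t(2) by (simp add: o_def)
    note cl = cluster_point[OF \<omega> d qt w]
    obtain c \<epsilon> U where U: "0 < c" "0 < \<epsilon>" "open U" "z \<in> U"
      and ineq: "\<And>x s v. x \<in> U \<Longrightarrow> F x + ereal (H x) = ereal s \<Longrightarrow> \<omega> < s \<Longrightarrow> s < \<omega> + \<epsilon> \<Longrightarrow>
        v \<in> limiting_subdiff (\<lambda>z. F z + ereal (H z)) x \<Longrightarrow> (s - \<omega>) powr \<theta> \<le> c * norm v"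
      by (rule KL_exponent_inequality[OF KL cl(2,1)]) blast
    have "\<forall>\<^sub>F n in sequentially. w (Suc (q (t n))) \<in> U"
      using w U(3,4) by (rule topological_tendstoD)
    moreover have "(\<lambda>n. ?\<psi> (q (t n))) \<longlonglongrightarrow> \<omega>"
      using filterlim_compose[OF \<omega> filterlim_compose[OF filterlim_Suc qt]] .
    then have "\<forall>\<^sub>F n in sequentially. ?\<psi> (q (t n)) < \<omega> + \<epsilon>"
      using U by (intro order_tendstoD(2)) auto
    \<comment> \<open>c C is the KL constant times the residual constant; beyond this n the assumed
      failure, with factor at least n + 1, contradicts the KL estimate.\<close>
    moreover have "\<forall>\<^sub>F n in sequentially. nat \<lceil>c * C\<rceil> \<le> n" by (rule eventually_ge_at_top)
    ultimately have "\<forall>\<^sub>F n in sequentially. False"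
    proof eventually_elim
      case (elim n)
      let ?k = "q (t n)"
      have "(?\<psi> ?k - \<omega>) powr \<theta> \<le> c * norm (p (Suc ?k) + gradient H (w (Suc ?k)))"
        using elim q(2) subsetD[OF frechet_subset_limiting_subdiff frechet_subdiff_iterate]
        by (intro ineq[of "w (Suc ?k)"]) (auto simp: F_w)
      also have "\<dots> \<le> c * (C * d (Suc ?k))" using U residual by (intro mult_left_mono) auto
      also have "\<dots> \<le> real (Suc (t n)) * d (Suc ?k)"
      proof -
        have "c * C \<le> real n" using elim(3) by linarith
        also have "\<dots> \<le> real (Suc (t n))" using seq_suble[OF t(1), of n] by simp
        finally have "(c * C) * d (Suc ?k) \<le> real (Suc (t n)) * d (Suc ?k)"
          by (rule mult_right_mono[OF _ d_nonneg])
        then show ?thesis by (simp add: mult.assoc)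
      qed
      finally show False using q(3)[of "t n"] by simp
    qed
    then show False by simp
  qed
  then show ?thesis using that by blast
qed

text \<open>The error of \<open>u\<close> is at most the error of the objective plus \<sigma> d^2,
  hence at most twice the larger of the two. The KL estimate bounds the first, and d^(2 \<theta>)
  \<le> d for d \<le> 1 handles the second. Squaring the resulting bound e^\<theta> \<le> B d and
  inserting it into \<open>descent\<close> gives the recursion.\<close>

lemma error_recursion:
  assumes KL: "KL_exponent (\<lambda>z. F z + ereal (H z)) \<theta>" and \<theta>: "1 / 2 \<le> \<theta>"
    and u: "u \<longlonglongrightarrow> \<omega>" and d: "d \<longlonglongrightarrow> 0" and \<omega>: "(\<lambda>k. \<phi> k + H (w k)) \<longlonglongrightarrow> \<omega>"
  obtains A N where "0 < A"
    "\<And>k. N \<le> k \<Longrightarrow> \<omega> \<le> u (Suc k) \<Longrightarrow>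
      (u (Suc k) - \<omega>) + A * (u (Suc k) - \<omega>) powr (2 * \<theta>) \<le> window_max m u k - \<omega>"
proof -
  let ?\<psi> = "\<lambda>k. \<phi> (Suc k) + H (w (Suc k))"
  obtain A N where A: "0 < A"
    and N: "\<And>k. N \<le> k \<Longrightarrow> \<omega> < ?\<psi> k \<Longrightarrow> (?\<psi> k - \<omega>) powr \<theta> \<le> A * d (Suc k)"
    using KL_along_iterates[OF KL \<omega> d] by metis
  have "\<forall>\<^sub>F k in sequentially. d (Suc k) < 1"
    by (rule order_tendstoD(2)[OF LIMSEQ_Suc[OF d]]) simp
  then obtain N' where N': "\<And>k. N' \<le> k \<Longrightarrow> d (Suc k) < 1"
    unfolding eventually_sequentially by blast
  define B where "B = 2 powr \<theta> * max A (\<sigma> powr \<theta>)"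
  have B: "0 < B" using A by (simp add: B_def less_max_iff_disj)
  have main: "(u (Suc k) - \<omega>) + a / B\<^sup>2 * (u (Suc k) - \<omega>) powr (2 * \<theta>) \<le> window_max m u k - \<omega>"
    if k: "max N N' \<le> k" and uk: "\<omega> \<le> u (Suc k)" for k
  proof -
    let ?d = "d (Suc k)" and ?e = "u (Suc k) - \<omega>" and ?m = "max A (\<sigma> powr \<theta>)"
    have d01: "0 \<le> ?d" "?d \<le> 1" using d_nonneg[of k] N'[of k] k by auto
    have "?e powr \<theta> \<le> B * ?d"
    \<comment> \<open>The second case includes iterates whose objective is at most \<omega>, about
      which the KL inequality says nothing.\<close>
    proof (cases "\<sigma> * ?d\<^sup>2 < ?\<psi> k - \<omega>")
      case True
      have "0 \<le> \<sigma> * ?d\<^sup>2" using constants by simp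
      then have pos: "\<omega> < ?\<psi> k" using True by linarith
      have "?e \<le> 2 * (?\<psi> k - \<omega>)" using u_le[of "Suc k"] True by simp
      then have "?e powr \<theta> \<le> (2 * (?\<psi> k - \<omega>)) powr \<theta>" using \<theta> uk by (intro powr_mono2) auto
      also have "\<dots> = 2 powr \<theta> * (?\<psi> k - \<omega>) powr \<theta>" using pos by (intro powr_mult) 
      also have "\<dots> \<le> 2 powr \<theta> * (A * ?d)" using N[of k] k pos by (intro mult_left_mono) auto
      also have "\<dots> \<le> 2 powr \<theta> * (?m * ?d)" using d01 by (intro mult_left_mono mult_right_mono) auto
      finally show ?thesis by (simp add: B_def mult_ac)
    next
      case False
      then have "?e \<le> 2 * (\<sigma> * ?d\<^sup>2)" using u_le[of "Suc k"] by simp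
      then have "?e powr \<theta> \<le> (2 * (\<sigma> * ?d\<^sup>2)) powr \<theta>" using \<theta> uk by (intro powr_mono2) auto
      also have "\<dots> = 2 powr \<theta> * (\<sigma> powr \<theta> * ?d\<^sup>2 powr \<theta>)" using constants by (simp add: powr_mult)
      also have "?d\<^sup>2 powr \<theta> \<le> ?d"
      proof (cases "?d = 0")
        case False
        then have "?d\<^sup>2 powr \<theta> = ?d powr (2 * \<theta>)"
          using d01 by (simp add: powr_powr flip: powr_numeral)
        also have "\<dots> \<le> ?d powr 1" using d01 \<theta> by (intro powr_mono') auto
        finally show ?thesis using d01 by simp
      qed simp
      then have "2 powr \<theta> * (\<sigma> powr \<theta> * ?d\<^sup>2 powr \<theta>) \<le> 2 powr \<theta> * (?m * ?d)"
        using d01 A by (intro mult_left_mono mult_mono) auto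
      finally show ?thesis by (simp add: B_def mult_ac)
    qed
    then have "(?e powr \<theta>)\<^sup>2 \<le> (B * ?d)\<^sup>2" by (rule power_mono) simp
    also have "(?e powr \<theta>)\<^sup>2 = ?e powr (2 * \<theta>)"
      by (simp add: power2_eq_square flip: powr_add)
    finally have "?e powr (2 * \<theta>) / B\<^sup>2 \<le> ?d\<^sup>2"
      using B by (simp add: power_mult_distrib field_simps)
    then have "a * (?e powr (2 * \<theta>) / B\<^sup>2) \<le> a * ?d\<^sup>2" using constants by (intro mult_left_mono) auto
    then show ?thesis using descent[of k] by simp
  qed
  show ?thesis
    by (rule that[of "a / B\<^sup>2" "max N N'"]) (use main constants B in auto)
qed

end

text \<open>The shifted window maxima are sampled every m + 1 indices, where they obey a plain
  contraction, and monotonicity transfers the rate to all k.\<close>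

lemma (in prox_descent) KL_rate:
  assumes KL: "KL_exponent (\<lambda>z. F z + ereal (H z)) \<theta>" and \<theta>: "1 / 2 \<le> \<theta>" "\<theta> < 1"
  obtains \<omega> \<rho> \<gamma> where "(\<lambda>k. \<phi> k + H (w k)) \<longlonglongrightarrow> \<omega>" "0 < \<rho>" "\<rho> < 1" "0 < \<gamma>"
    "\<forall>\<^sub>F k in sequentially. \<phi> k + H (w k) - \<omega> \<le>
      (if \<theta> = 1 / 2 then \<gamma> * \<rho> powi \<lceil>(real k - 1) / (real m + 1)\<rceil>
       else \<gamma> * real k powr ((1 - \<theta>) / (1 - 2 * \<theta>)))"
proof -
  obtain \<omega> where u: "u \<longlonglongrightarrow> \<omega>" and d: "d \<longlonglongrightarrow> 0" and \<omega>_le: "\<And>k. \<omega> \<le> window_max m u k"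
    and \<omega>: "(\<lambda>k. \<phi> k + H (w k)) \<longlonglongrightarrow> \<omega>" using convergence by metis
  obtain A N where A: "0 < A" and rec: "\<And>k. N \<le> k \<Longrightarrow> \<omega> \<le> u (Suc k) \<Longrightarrow>
      (u (Suc k) - \<omega>) + A * (u (Suc k) - \<omega>) powr (2 * \<theta>) \<le> window_max m u k - \<omega>"
    using error_recursion[OF KL \<theta>(1) u d \<omega>] by metis
  define V where "V k = window_max m (\<lambda>k. u k - \<omega>) k" for k
  have V_eq: "V k = window_max m u k - \<omega>" for k by (simp add: V_def window_max_diff_const)
  have V0: "0 \<le> V k" for k using \<omega>_le[of k] by (simp add: V_eq)
  have decV: "decseq V" using u_decseq by (simp add: V_eq monotone_on_def)
  have contr: "V (k + Suc m) + A * V (k + Suc m) powr (2 * \<theta>) \<le> V k" if "N \<le> k" for k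
    unfolding V_def
  proof (rule window_max_contraction[OF _ _ _ _ _ that])
    show "decseq (window_max m (\<lambda>k. u k - \<omega>))" using decV by (simp add: V_def[abs_def])
    show "0 \<le> window_max m (\<lambda>k. u k - \<omega>) k" for k using V0[of k] by (simp add: V_def)
    show "(u (Suc k) - \<omega>) + A * (u (Suc k) - \<omega>) powr (2 * \<theta>) \<le> window_max m (\<lambda>k. u k - \<omega>) k"
      if "N \<le> k" "0 \<le> u (Suc k) - \<omega>" for k
      using rec[of k] that by (simp add: window_max_diff_const)
  qed (use A \<theta> in auto)
  define t where "t n = V (N + n * Suc m)" for n
  have t0: "0 \<le> t n" for n by (simp add: t_def V0)
  have t_step: "t (Suc n) + A * t (Suc n) powr (2 * \<theta>) \<le> t n" for n
    using contr[of "N + n * Suc m"] by (simp add: t_def add_ac)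
  have le_t: "\<phi> k + H (w k) - \<omega> \<le> t ((k - N) div Suc m)" if "N \<le> k" for k
  proof -
    have "\<phi> k + H (w k) - \<omega> \<le> u k - \<omega>" using u_ge[of k] by simp
    also have "\<dots> \<le> V k" unfolding V_def by (rule window_max_ge) auto
    also have "\<dots> \<le> V (N + (k - N) div Suc m * Suc m)"
    proof (rule decseqD[OF decV])
      have "(k - N) div Suc m * Suc m \<le> k - N" by (rule div_times_less_eq_dividend)
      then show "N + (k - N) div Suc m * Suc m \<le> k" using that by simp
    qed
    finally show ?thesis by (simp add: t_def)
  qed
  \<comment> \<open>Rounding down in the integer quotient loses less than one sampling period; this
    is how sample counts are converted into rates in k.\<close>
  have quot: "(real k - real N) / (real m + 1) \<le> real ((k - N) div Suc m) + 1" if "N \<le> k" for k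
  proof -
    have "k - N < Suc ((k - N) div Suc m) * Suc m"
      using dividend_less_div_times[of "Suc m" "k - N"] by simp
    then have "real (k - N) \<le> (real ((k - N) div Suc m) + 1) * (real m + 1)"
      by (metis less_imp_le of_nat_Suc of_nat_le_iff of_nat_mult add.commute)
    then show ?thesis using that by (simp add: pos_divide_le_eq of_nat_diff)
  qed
  show ?thesis
  proof (cases "\<theta> = 1 / 2")
    case True
    define \<rho> where "\<rho> = 1 / (1 + A)"
    have \<rho>: "0 < \<rho>" "\<rho> < 1" using A by (auto simp: \<rho>_def)
    have t_geo: "t n \<le> \<rho> ^ n * t 0" for n
      unfolding \<rho>_def
    proof (rule contraction_geometric[OF A])
      show "t (Suc n) + A * t (Suc n) \<le> t n" for n
        using t_step[of n] t0[of "Suc n"] True by simp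
    qed
    \<comment> \<open>The ceiling in the claim exceeds the number n of completed samples by at most
      N + 1, which the division compensates; adding 1 keeps \<gamma> positive when t 0 = 0.\<close>
    define \<gamma> where "\<gamma> = (t 0 + 1) / \<rho> ^ (N + 1)"
    have \<gamma>: "0 < \<gamma>" using t0[of 0] \<rho> by (simp add: \<gamma>_def)
    have "\<phi> k + H (w k) - \<omega> \<le> \<gamma> * \<rho> powi \<lceil>(real k - 1) / (real m + 1)\<rceil>" if k: "N \<le> k" for k
    proof -
      define n where "n = (k - N) div Suc m"
      have "(real k - 1) / (real m + 1) \<le> (real k - real N) / (real m + 1) + real N"
        by (simp add: field_simps)
      also have "\<dots> \<le> real (n + (N + 1))" using quot[OF k] by (simp add: n_def)
      finally have "\<lceil>(real k - 1) / (real m + 1)\<rceil> \<le> int (n + (N + 1))"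
        by (simp add: ceiling_le_iff)
      then have mono: "\<rho> powi int (n + (N + 1)) \<le> \<rho> powi \<lceil>(real k - 1) / (real m + 1)\<rceil>"
        using \<rho> by (intro power_int_decreasing) auto
      have "\<phi> k + H (w k) - \<omega> \<le> t n" using le_t[OF k] by (simp add: n_def)
      also have "\<dots> \<le> \<rho> ^ n * t 0" by (rule t_geo)
      also have "\<dots> \<le> \<rho> ^ n * (t 0 + 1)" using \<rho> by (intro mult_left_mono) auto
      also have "\<dots> = \<gamma> * \<rho> powi int (n + (N + 1))"
        using \<rho> by (simp only: power_int_of_nat power_add \<gamma>_def) simp
      also have "\<dots> \<le> \<gamma> * \<rho> powi \<lceil>(real k - 1) / (real m + 1)\<rceil>"
        using mono \<gamma> by (intro mult_left_mono) auto
      finally show ?thesis .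
    qed
    then have "\<forall>\<^sub>F k in sequentially. \<phi> k + H (w k) - \<omega> \<le>
        \<gamma> * \<rho> powi \<lceil>(real k - 1) / (real m + 1)\<rceil>"
      unfolding eventually_sequentially by blast
    then show ?thesis using that[OF \<omega> \<rho> \<gamma>] True by simp
  next
    case False
    define s where "s = 1 / (2 * \<theta> - 1)"
    have s: "0 < s" using \<theta> False by (simp add: s_def)
    have p: "1 < 2 * \<theta>" using \<theta> False by simp
    obtain K where K: "0 < K" "\<And>n. t n \<le> K * real (Suc n) powr (- s)"
      using contraction_sublinear[where t = t, OF A p t0 t_step] unfolding s_def by metis
    \<comment> \<open>The factor comes from n + 1 \<ge> k / (2 (m + 1)), valid as soon as k \<ge> 2
      N.\<close>
    define \<gamma> where "\<gamma> = K * (2 * (real m + 1)) powr s"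
    have \<gamma>: "0 < \<gamma>" using K by (simp add: \<gamma>_def)
    have "\<phi> k + H (w k) - \<omega> \<le> \<gamma> * real k powr ((1 - \<theta>) / (1 - 2 * \<theta>))" if k: "2 * N + 1 \<le> k" for k
    proof -
      define n where "n = (k - N) div Suc m"
      have Nk: "N \<le> k" "2 * real N \<le> real k" "1 \<le> real k" using k by auto
      have "real k / (2 * (real m + 1)) = (real k / 2) / (real m + 1)" by (simp add: field_simps)
      also have "\<dots> \<le> (real k - real N) / (real m + 1)" using Nk by (intro divide_right_mono) auto
      also have "\<dots> \<le> real (Suc n)" using quot[OF Nk(1)] by (simp add: n_def)
      finally have ge: "real k / (2 * (real m + 1)) \<le> real (Suc n)" .
      have "\<phi> k + H (w k) - \<omega> \<le> t n" using le_t[OF Nk(1)] by (simp add: n_def)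
      also have "\<dots> \<le> K * real (Suc n) powr (- s)" by (rule K)
      also have "\<dots> \<le> K * (real k / (2 * (real m + 1))) powr (- s)"
        using K Nk s ge by (intro mult_left_mono powr_mono2') auto
      also have "\<dots> = \<gamma> * real k powr (- s)"
        using Nk by (simp add: \<gamma>_def powr_divide powr_minus_divide)
      also have "\<dots> \<le> \<gamma> * real k powr ((1 - \<theta>) / (1 - 2 * \<theta>))"
      \<comment> \<open>The recursion yields the exponent 1/(1 - 2 \<theta>), which lies below the
        claimed one because 1 - \<theta> < 1 and the denominator is negative.\<close>
      proof (intro mult_left_mono powr_mono)
        show "- s \<le> (1 - \<theta>) / (1 - 2 * \<theta>)" using p \<theta> by (simp add: s_def field_simps)
      qed (use \<gamma> Nk in auto)
      finally show ?thesis .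
    qed
    then have "\<forall>\<^sub>F k in sequentially. \<phi> k + H (w k) - \<omega> \<le> \<gamma> * real k powr ((1 - \<theta>) / (1 - 2 * \<theta>))"
      unfolding eventually_sequentially by blast
    \<comment> \<open>The value 1/2 for the ratio is a placeholder: in this case the bound does not
      contain it.\<close>
    then show ?thesis using that[OF \<omega> _ _ \<gamma>, of "1 / 2"] False by simp
  qed
qed

section \<open>The PALMenls iteration\<close>

text \<open>Compare z with z' in the prox objective and expand the squared distance from z' to c
  around z: the cross term becomes the linear part and the remaining square the quadratic
  penalty.\<close>

lemma prox_lower_bound:
  assumes \<tau>: "0 < \<tau>" and z: "z \<in> prox \<tau> h c" and hz: "h z = ereal r" and hz': "h z' = ereal s"
  shows "r + ((1 / \<tau>) *\<^sub>R (c - z)) \<bullet> (z' - z) - 1 / (2 * \<tau>) * (norm (z' - z))\<^sup>2 \<le> s"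
proof -
  have "\<not> ereal (1 / (2 * \<tau>) * (norm (z' - c))\<^sup>2) + h z' < ereal (1 / (2 * \<tau>) * (norm (z - c))\<^sup>2) + h z"
    using z unfolding prox_def is_arg_min_def by blast
  then have le: "1 / (2 * \<tau>) * (norm (z - c))\<^sup>2 + r \<le> 1 / (2 * \<tau>) * (norm (z' - c))\<^sup>2 + s"
    by (simp add: hz hz')
  have "(norm (z' - c))\<^sup>2 = (norm (z' - z))\<^sup>2 - 2 * ((c - z) \<bullet> (z' - z)) + (norm (z - c))\<^sup>2"
    by (simp add: power2_norm_eq_inner inner_simps inner_commute)
  then have "1 / (2 * \<tau>) * (norm (z' - c))\<^sup>2 = 1 / (2 * \<tau>) * (norm (z' - z))\<^sup>2
      - (1 / \<tau>) * ((c - z) \<bullet> (z' - z)) + 1 / (2 * \<tau>) * (norm (z - c))\<^sup>2"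
    using \<tau> by (simp add: field_simps)
  with le show ?thesis by simp
qed

text \<open>The standing convention places the iterates scaled by 1 + 2 \<beta>max in the balls; the
  iterates themselves have no larger norm.\<close>

lemma origin_ball_scale:
  assumes "origin_ball B" "1 \<le> c" "c *\<^sub>R v \<in> B"
  shows "v \<in> B"
proof -
  have "norm v \<le> \<bar>c\<bar> * norm v" using assms(2) by (simp add: mult_right_le_one_le mult_le_cancel_right1)
  then show ?thesis using assms by (auto simp: origin_ball_def)
qed

lemma origin_ball_bounded: "origin_ball B \<Longrightarrow> bounded B"
  by (auto simp: origin_ball_def)

text \<open>Provides points of the ball that differ from \<open>a\<close> and converge to it, as
  approximants in difference quotients that exclude equal arguments.\<close>

lemma origin_ball_islimpt:
  fixes B :: "'a::euclidean_space set"
  assumes "origin_ball B" "a \<in> B"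
  shows "a islimpt B"
proof -
  obtain r where r: "0 < r" "B = ball 0 r \<or> B = cball 0 r" using assms(1) by (auto simp: origin_ball_def)
  then have "a islimpt ball 0 r" using assms(2) by (auto simp: islimpt_ball)
  then show ?thesis by (rule islimpt_subset) (use r in auto)
qed

text \<open>The difference quotients defining $M$ exclude equal first arguments; that case is a limit.\<close>

lemma gradient_x_lipschitz_snd:
  fixes H :: "'a::euclidean_space \<times> 'b::euclidean_space \<Rightarrow> real"
  assumes H: "smooth_fun H" and B1: "origin_ball B1"
    and M_finite: "bdd_above {norm (gradient_x H a b - gradient_x H a' b') / norm ((a, b) - (a', b')) |
                      a a' b b'. a \<in> B1 \<and> a' \<in> B1 \<and> a \<noteq> a' \<and> b \<in> B2 \<and> b' \<in> B2 \<and> b \<noteq> b'}"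
  obtains M where "0 \<le> M" "\<And>a b b'. a \<in> B1 \<Longrightarrow> b \<in> B2 \<Longrightarrow> b' \<in> B2 \<Longrightarrow>
    norm (gradient_x H a b - gradient_x H a b') \<le> M * norm (b - b')"
proof -
  obtain M where M: "\<And>a a' b b'. a \<in> B1 \<Longrightarrow> a' \<in> B1 \<Longrightarrow> a \<noteq> a' \<Longrightarrow> b \<in> B2 \<Longrightarrow> b' \<in> B2 \<Longrightarrow> b \<noteq> b' \<Longrightarrow>
      norm (gradient_x H a b - gradient_x H a' b') / norm ((a, b) - (a', b')) \<le> M"
    using M_finite unfolding bdd_above_def by blast
  have "norm (gradient_x H a b - gradient_x H a b') \<le> \<bar>M\<bar> * norm (b - b')"
    if ab: "a \<in> B1" "b \<in> B2" "b' \<in> B2" for a b b'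
  proof (cases "b = b'")
    case False
    \<comment> \<open>Replacing the second copy of \<open>a\<close> by \<open>X n\<close> makes the
      quotient admissible; in the limit the denominator reduces to the distance of b and b'.\<close>
    obtain X where X: "\<And>n. X n \<in> B1 - {a}" "X \<longlonglongrightarrow> a"
      using origin_ball_islimpt[OF B1 ab(1)] unfolding islimpt_sequential by blast
    have cont: "continuous_on UNIV (gradient H)" using H by (simp add: smooth_fun_def)
    have "(\<lambda>n. gradient H (X n, b')) \<longlonglongrightarrow> gradient H (a, b')"
      using continuous_on_tendsto_compose[OF cont, of "\<lambda>n. (X n, b')" "(a, b')"] X(2)
      by (simp add: tendsto_Pair)
    then have "(\<lambda>n. gradient_x H (X n) b') \<longlonglongrightarrow> gradient_x H a b'"
      using tendsto_fst by (simp add: gradient_x_eq_fst[OF H])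
    then have "(\<lambda>n. norm (gradient_x H a b - gradient_x H (X n) b'))
        \<longlonglongrightarrow> norm (gradient_x H a b - gradient_x H a b')"
      by (intro tendsto_intros)
    moreover have "(\<lambda>n. \<bar>M\<bar> * norm ((a, b) - (X n, b'))) \<longlonglongrightarrow> \<bar>M\<bar> * norm ((a, b) - (a, b'))"
      by (intro tendsto_intros X)
    ultimately have "norm (gradient_x H a b - gradient_x H a b') \<le> \<bar>M\<bar> * norm ((a, b) - (a, b'))"
    proof (rule LIMSEQ_le, intro exI allI impI)
      fix n
      have "0 < norm ((a, b) - (X n, b'))" using False by (simp add: zero_prod_def)
      moreover have "norm (gradient_x H a b - gradient_x H (X n) b') / norm ((a, b) - (X n, b')) \<le> \<bar>M\<bar>"
        using M[of a "X n" b b'] X(1)[of n] ab False by fastforce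
      ultimately show "norm (gradient_x H a b - gradient_x H (X n) b') \<le> \<bar>M\<bar> * norm ((a, b) - (X n, b'))"
        by (simp add: pos_divide_le_eq)
    qed
    then show ?thesis by (simp add: norm_Pair)
  qed simp
  then show ?thesis using that[of "\<bar>M\<bar>"] by simp
qed

text \<open>Only the accepted trial is kept. Backtracking leaves the extrapolation weight between 0
  and \<beta>max, and the cutoff keeps both prox parameters at or above \<tau>min.\<close>

lemma PALMenls_step:
  assumes run: "PALMenls f g H \<delta> \<alpha> \<tau>min \<tau>max \<beta>max \<eta> \<eta>1 \<eta>2 m x y" and \<eta>: "0 < \<eta>" "\<eta> < 1"
  obtains \<beta> \<tau>1 \<tau>2 where "0 \<le> \<beta>" "\<beta> \<le> \<beta>max" "\<tau>min \<le> \<tau>1" "\<tau>min \<le> \<tau>2"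
    "palm_step f g H \<beta> \<tau>1 \<tau>2 (x (k - 1), y (k - 1)) (x k, y k) (x (Suc k), y (Suc k))"
    "nls_accept f g H \<delta> \<alpha> m x y k (x (Suc k), y (Suc k))"
proof -
  obtain \<beta>0 \<tau>1 \<tau>2 w n where \<beta>0: "\<beta>0 \<in> {0..\<beta>max}"
    and step: "\<forall>l\<le>n. palm_step f g H (\<beta>0 * \<eta> ^ l) (max (\<tau>1 * \<eta>1 ^ l) \<tau>min) (max (\<tau>2 * \<eta>2 ^ l) \<tau>min)
                  (x (k - 1), y (k - 1)) (x k, y k) (w l)"
    and acc: "nls_accept f g H \<delta> \<alpha> m x y k (w n)" and eq: "(x (Suc k), y (Suc k)) = w n"
    using run unfolding PALMenls_def by meson
  have "\<beta>0 * \<eta> ^ n \<le> \<beta>0 * 1" using \<beta>0 \<eta> by (intro mult_left_mono power_le_one) auto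
  then have "\<beta>0 * \<eta> ^ n \<le> \<beta>max" using \<beta>0 by simp
  moreover have "0 \<le> \<beta>0 * \<eta> ^ n" using \<beta>0 \<eta> by simp
  ultimately show ?thesis
    using that[of "\<beta>0 * \<eta> ^ n" "max (\<tau>1 * \<eta>1 ^ n) \<tau>min" "max (\<tau>2 * \<eta>2 ^ n) \<tau>min"] step acc
    unfolding eq by simp
qed

text \<open>The induction is strong because the acceptance test compares with the whole window. At
  index 0 the current and previous points coincide, so the merit function equals \<Psi>
  there.\<close>

lemma Upsilon_le_start:
  assumes acc: "\<And>k. nls_accept f g H \<delta> \<alpha> m x y k (x (Suc k), y (Suc k))" and \<alpha>: "0 \<le> \<alpha>"
  shows "Upsilon f g H \<delta> (zseq x y k) \<le> Psi f g H (x 0, y 0)"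
proof (induction k rule: less_induct)
  case (less k)
  show ?case
  proof (cases k)
    case 0
    then show ?thesis by (simp add: Upsilon_def zseq_def Psi_def zero_ereal_def[symmetric])
  next
    case (Suc j)
    let ?c = "\<alpha> / 2 * (norm ((x (Suc j), y (Suc j), x j, y j) - zseq x y j))\<^sup>2"
    have "Upsilon f g H \<delta> (zseq x y k) \<le> (MAX i\<in>{j - m..j}. Upsilon f g H \<delta> (zseq x y i)) - ereal ?c"
      using acc[of j] by (simp add: nls_accept_def zseq_def Suc)
    also have "\<dots> \<le> (MAX i\<in>{j - m..j}. Upsilon f g H \<delta> (zseq x y i))"
    proof -
      have "0 \<le> ?c" using \<alpha> by simp
      then show ?thesis by (metis ereal_diff_le_self ereal_less_eq(5))
    qed
    also have "\<dots> \<le> Psi f g H (x 0, y 0)"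
      by (rule Max.boundedI) (use less Suc in auto)
    finally show ?thesis .
  qed
qed

theorem corollary5p4:
  fixes f :: "'a::euclidean_space \<Rightarrow> ereal"
    and g :: "'b::euclidean_space \<Rightarrow> ereal"
    and H :: "'a \<times> 'b \<Rightarrow> real"
    and L1 :: "'b \<Rightarrow> real" and L2 :: "'a \<Rightarrow> real"
    and m :: nat
    and \<delta> \<alpha> \<tau>min \<tau>max \<beta>max \<eta> \<eta>1 \<eta>2 L \<theta> :: real
    and x :: "nat \<Rightarrow> 'a" and y :: "nat \<Rightarrow> 'b"
    and B1 :: "'a set" and B2 :: "'b set"
  assumes f: "proper_fun f" "lsc_fun f" "bounded_below f"
    and g: "proper_fun g" "lsc_fun g" "bounded_below g"
    and H: "smooth_fun H"
    and L1: "\<And>b. (L1 b)-lipschitz_on UNIV (\<lambda>a. gradient_x H a b)"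
    and L2: "\<And>a. (L2 a)-lipschitz_on UNIV (\<lambda>b. gradient_y H a b)"
    and Psi: "coercive (Psi f g H)" "bounded_below (Psi f g H)"
    and start: "Psi f g H (x 0, y 0) < \<infinity>"
    and L_finite: "bdd_above ((\<lambda>(a, b). max (L1 b) (L2 a)) ` {w. Psi f g H w \<le> Psi f g H (x 0, y 0)})"
    and L: "L = (SUP (a, b)\<in>{w. Psi f g H w \<le> Psi f g H (x 0, y 0)}. max (L1 b) (L2 a))"
    and delta: "0 < \<delta>" "\<delta> < 1"
    and alpha: "0 < \<alpha>" "\<alpha> \<le> \<delta> / 2"
    and tau: "0 < \<tau>min" "\<tau>min < 1 / (L + \<delta> + 2 * \<alpha>)" "1 / (L + \<delta> + 2 * \<alpha>) < \<tau>max"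
    and beta: "0 \<le> \<beta>max"
    and eta: "0 < \<eta>" "\<eta> < 1" "0 < \<eta>1" "\<eta>1 < 1" "0 < \<eta>2" "\<eta>2 < 1"
    and run: "PALMenls f g H \<delta> \<alpha> \<tau>min \<tau>max \<beta>max \<eta> \<eta>1 \<eta>2 m x y"
    and B1: "origin_ball B1" "\<And>k. (1 + 2 * \<beta>max) *\<^sub>R x k \<in> B1"
    and B2: "origin_ball B2" "\<And>k. (1 + 2 * \<beta>max) *\<^sub>R y k \<in> B2"
    and M_finite: "bdd_above {norm (gradient_x H a b - gradient_x H a' b') / norm ((a, b) - (a', b')) |
                      a a' b b'. a \<in> B1 \<and> a' \<in> B1 \<and> a \<noteq> a' \<and> b \<in> B2 \<and> b' \<in> B2 \<and> b \<noteq> b'}"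
    and L2bar_finite: "bdd_above (L2 ` B1)"
    and KL: "KL_exponent (Psi f g H) \<theta>" "1 / 2 \<le> \<theta>" "\<theta> < 1"
  shows "\<exists>\<omega>::real. (\<lambda>k. Psi f g H (x k, y k)) \<longlonglongrightarrow> ereal \<omega> \<and>
    (\<exists>\<rho> \<gamma>::real. 0 < \<rho> \<and> \<rho> < 1 \<and> 0 < \<gamma> \<and>
      (\<forall>\<^sub>F k in sequentially. Psi f g H (x k, y k) - ereal \<omega> \<le>
         ereal (if \<theta> = 1 / 2 then \<gamma> * \<rho> powi \<lceil>(real k - 1) / (real m + 1)\<rceil>
                else \<gamma> * real k powr ((1 - \<theta>) / (1 - 2 * \<theta>)))))"
proof -
  define w where "w k = (x k, y k)" for k
  define F where "F z = f (fst z) + g (snd z)" for z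
  \<comment> \<open>\<open>real_of_ereal\<close> would send infinite values to 0; \<open>fin\<close>
    below excludes them along the iterates.\<close>
  define \<phi> where "\<phi> k = real_of_ereal (f (x k)) + real_of_ereal (g (y k))" for k
  define u where "u k = \<phi> k + H (w k) + \<delta> / 2 * (norm (x k - x (k - 1)))\<^sup>2
    + \<delta> / 2 * (norm (y k - y (k - 1)))\<^sup>2" for k
  define d where "d k = norm (zseq x y k - zseq x y (k - 1))" for k
  have Psi_eq: "Psi f g H = (\<lambda>z. F z + ereal (H z))"
    by (auto simp: Psi_def F_def fun_eq_iff)
  have step: "\<exists>\<beta> \<tau>1 \<tau>2. 0 \<le> \<beta> \<and> \<beta> \<le> \<beta>max \<and> \<tau>min \<le> \<tau>1 \<and> \<tau>min \<le> \<tau>2 \<and>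
    palm_step f g H \<beta> \<tau>1 \<tau>2 (x (k - 1), y (k - 1)) (x k, y k) (x (Suc k), y (Suc k))" for k
    by (rule PALMenls_step[OF run eta(1,2), of k]) blast
  have acc: "nls_accept f g H \<delta> \<alpha> m x y k (x (Suc k), y (Suc k))" for k
    by (rule PALMenls_step[OF run eta(1,2), of k])
  have f_not: "f a \<noteq> -\<infinity>" and g_not: "g b \<noteq> -\<infinity>" for a b
    using f(1) g(1) by (auto simp: proper_fun_def)
  have Ups_le: "Upsilon f g H \<delta> (zseq x y k) \<le> Psi f g H (x 0, y 0)" for k
    using acc alpha(1) by (intro Upsilon_le_start) auto
  have fin: "f (x k) \<noteq> \<infinity>" "g (y k) \<noteq> \<infinity>" for k
  proof -
    have "Upsilon f g H \<delta> (zseq x y k) < \<infinity>" using Ups_le start by (rule order.strict_trans1)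
    then show "f (x k) \<noteq> \<infinity>" "g (y k) \<noteq> \<infinity>"
      using f_not[of "x k"] g_not[of "y k"] by (auto simp: Upsilon_def zseq_def)
  qed
  have fx: "f (x k) = ereal (real_of_ereal (f (x k)))" and gy: "g (y k) = ereal (real_of_ereal (g (y k)))" for k
    using fin[of k] f_not[of "x k"] g_not[of "y k"] by (auto simp: ereal_real)
  have F_w: "F (w k) = ereal (\<phi> k)" for k
    using fx[of k] gy[of k] by (metis F_def \<phi>_def fst_conv plus_ereal.simps(1) snd_conv w_def)
  have Psi_w: "Psi f g H (x k, y k) = ereal (\<phi> k + H (w k))" for k
    using F_w[of k] by (simp add: Psi_eq w_def)
  have Ups_eq: "Upsilon f g H \<delta> (zseq x y k) = ereal (u k)" for k
  proof -
    have "Upsilon f g H \<delta> (zseq x y k) = F (w k) + ereal (H (w k))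
        + ereal (\<delta> / 2 * (norm (x k - x (k - 1)))\<^sup>2) + ereal (\<delta> / 2 * (norm (y k - y (k - 1)))\<^sup>2)"
      by (simp add: Upsilon_def zseq_def F_def w_def)
    then show ?thesis by (simp add: F_w u_def)
  qed
  have d_Suc: "d (Suc k) = norm ((x (Suc k), y (Suc k), x k, y k) - zseq x y k)" for k
    by (simp add: d_def zseq_def)
  have descent: "u (Suc k) \<le> window_max m u k - \<alpha> / 2 * (d (Suc k))\<^sup>2" for k
  proof -
    have "(MAX j\<in>{k - m..k}. ereal (u j)) = ereal (window_max m u k)"
      unfolding window_max_def
      using mono_Max_commute[of ereal "u ` {k - m..k}"] by (simp add: mono_def image_image)
    moreover have "zseq x y (Suc k) = (x (Suc k), y (Suc k), x k, y k)" by (simp add: zseq_def)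
    ultimately have "ereal (u (Suc k)) \<le> ereal (window_max m u k) - ereal (\<alpha> / 2 * (d (Suc k))\<^sup>2)"
      using acc[of k] unfolding nls_accept_def d_Suc by (simp flip: Ups_eq)
    then show ?thesis by simp
  qed
  have norm_zdiff: "(d (Suc k))\<^sup>2 = (norm (w (Suc k) - w k))\<^sup>2
      + (norm (x k - x (k - 1)))\<^sup>2 + (norm (y k - y (k - 1)))\<^sup>2" for k
    by (simp add: d_Suc zseq_def w_def norm_Pair)
  have d_nonneg: "0 \<le> d k" for k by (simp add: d_def)
  have d_ge: "norm (w (Suc k) - w k) \<le> d (Suc k)" "norm (x k - x (k - 1)) \<le> d (Suc k)"
    "norm (y k - y (k - 1)) \<le> d (Suc k)" for k
    using norm_zdiff[of k] by (auto intro!: power2_le_imp_le[OF _ d_nonneg])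
  have dxy: "norm (x (Suc k) - x k) \<le> d (Suc k)" "norm (y (Suc k) - y k) \<le> d (Suc k)" for k
    using d_ge(1)[of k] norm_fst_le[of "x (Suc k) - x k" "y (Suc k) - y k"]
      norm_snd_le[of "y (Suc k) - y k" "x (Suc k) - x k"]
    by (auto simp: w_def)
  have u_ge: "\<phi> k + H (w k) \<le> u k" for k using delta by (simp add: u_def)
  have u_le: "u k \<le> \<phi> k + H (w k) + \<delta> / 2 * (d k)\<^sup>2" for k
  proof -
    have "(norm (x k - x (k - 1)))\<^sup>2 + (norm (y k - y (k - 1)))\<^sup>2 \<le> (d k)\<^sup>2"
      by (simp add: d_def zseq_def norm_Pair)
    then have "\<delta> / 2 * ((norm (x k - x (k - 1)))\<^sup>2 + (norm (y k - y (k - 1)))\<^sup>2) \<le> \<delta> / 2 * (d k)\<^sup>2"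
      using delta by (intro mult_left_mono) auto
    then show ?thesis unfolding u_def by (simp add: distrib_left)
  qed
  obtain b where "\<And>z. ereal b \<le> Psi f g H z" using Psi(2) by (auto simp: bounded_below_def)
  then have below: "b \<le> u k" for k
    using u_ge[of k] Psi_w[of k] by (metis ereal_less_eq(3) order_trans)

  \<comment> \<open>\<Psi> is at most the merit value, which never exceeds its start. So all
    iterates stay in the level set over which L is the supremum, and L bounds the Lipschitz
    constants met along the run.\<close>
  have level: "(x k, y k) \<in> {w. Psi f g H w \<le> Psi f g H (x 0, y 0)}" for k
  proof -
    have "Psi f g H (x k, y k) \<le> ereal (u k)" using u_ge[of k] by (simp add: Psi_w)
    also have "\<dots> \<le> Psi f g H (x 0, y 0)" using Ups_le[of k] by (simp add: Ups_eq)
    finally show ?thesis by simp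
  qed
  have "max (L1 (y k)) (L2 (x k)) \<le> L" for k
    unfolding L using cSUP_upper[OF level[of k] L_finite] by simp
  then have L12: "L1 (y k) \<le> L" "L2 (x k) \<le> L" for k by (metis max.bounded_iff)+
  have L0: "0 \<le> L" using L12(1)[of 0] lipschitz_on_nonneg[OF L1[of "y 0"]] by simp
  have xB: "x k \<in> B1" and yB: "y k \<in> B2" for k
    using origin_ball_scale[OF B1(1) _ B1(2)[of k]] origin_ball_scale[OF B2(1) _ B2(2)[of k]] beta by auto
  obtain M where M: "0 \<le> M" "\<And>a b b'. a \<in> B1 \<Longrightarrow> b \<in> B2 \<Longrightarrow> b' \<in> B2 \<Longrightarrow>
      norm (gradient_x H a b - gradient_x H a b') \<le> M * norm (b - b')"
    using gradient_x_lipschitz_snd[OF H B1(1) M_finite] by metis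

  \<comment> \<open>E times the step length bounds the distance from an extrapolated point to the
    new iterate: \<beta>max for the extrapolation, 1 for the move.\<close>
  define E where "E = 1 + \<beta>max"
  \<comment> \<open>The first bracket belongs to the x block, the second to the y block: E/\<tau>min
    from the prox step, L E from evaluating the gradient at the extrapolated point, M from the
    change of y.\<close>
  define C where "C = (1 / \<tau>min * E + L * E + M) + (1 / \<tau>min * E + L * E)"
  have C: "0 \<le> C" using tau(1) beta L0 M by (simp add: C_def E_def)
  have "\<exists>v. (\<forall>z s. F z = ereal s \<longrightarrow>
        \<phi> (Suc k) + v \<bullet> (z - w (Suc k)) - 1 / (2 * \<tau>min) * (norm (z - w (Suc k)))\<^sup>2 \<le> s) \<and>
      norm (v + gradient H (w (Suc k))) \<le> C * d (Suc k)" for k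
  proof -
    obtain \<beta> \<tau>1 \<tau>2 where \<beta>: "0 \<le> \<beta>" "\<beta> \<le> \<beta>max" and \<tau>: "\<tau>min \<le> \<tau>1" "\<tau>min \<le> \<tau>2"
      and ps: "palm_step f g H \<beta> \<tau>1 \<tau>2 (x (k - 1), y (k - 1)) (x k, y k) (x (Suc k), y (Suc k))"
      using step by blast
    have \<tau>0: "0 < \<tau>1" "0 < \<tau>2" using \<tau> tau(1) by auto
    define xt where "xt = x k + \<beta> *\<^sub>R (x k - x (k - 1))"
    define yt where "yt = y k + \<beta> *\<^sub>R (y k - y (k - 1))"
    let ?gx = "gradient_x H xt (y k)" and ?gy = "gradient_y H (x (Suc k)) yt"
    have px: "x (Suc k) \<in> prox \<tau>1 f (xt - \<tau>1 *\<^sub>R ?gx)" and py: "y (Suc k) \<in> prox \<tau>2 g (yt - \<tau>2 *\<^sub>R ?gy)"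
      using ps by (auto simp: palm_step_def xt_def yt_def Let_def)
    define vx where "vx = (1 / \<tau>1) *\<^sub>R (xt - \<tau>1 *\<^sub>R ?gx - x (Suc k))"
    define vy where "vy = (1 / \<tau>2) *\<^sub>R (yt - \<tau>2 *\<^sub>R ?gy - y (Suc k))"
    have "\<phi> (Suc k) + (vx, vy) \<bullet> (z - w (Suc k)) - 1 / (2 * \<tau>min) * (norm (z - w (Suc k)))\<^sup>2 \<le> s"
      if Fz: "F z = ereal s" for z s
    proof -
      obtain z1 z2 where z: "z = (z1, z2)" by (cases z)
      obtain s1 s2 where s: "f z1 = ereal s1" "g z2 = ereal s2" "s = s1 + s2"
        using Fz f_not[of z1] g_not[of z2] by (cases "f z1"; cases "g z2") (auto simp: F_def z)
      \<comment> \<open>Both prox parameters are at least \<tau>min, so 1/(2 \<tau>min) serves as a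
        common \<kappa> for the two blocks.\<close>
      have "1 / (2 * \<tau>1) * (norm (z1 - x (Suc k)))\<^sup>2 \<le> 1 / (2 * \<tau>min) * (norm (z1 - x (Suc k)))\<^sup>2"
        "1 / (2 * \<tau>2) * (norm (z2 - y (Suc k)))\<^sup>2 \<le> 1 / (2 * \<tau>min) * (norm (z2 - y (Suc k)))\<^sup>2"
        using \<tau> tau(1) by (auto intro!: mult_right_mono divide_left_mono)
      moreover note prox_lower_bound[OF \<tau>0(1) px fx s(1)] prox_lower_bound[OF \<tau>0(2) py gy s(2)]
      moreover have "(norm (z - w (Suc k)))\<^sup>2 = (norm (z1 - x (Suc k)))\<^sup>2 + (norm (z2 - y (Suc k)))\<^sup>2"
        "(vx, vy) \<bullet> (z - w (Suc k)) = vx \<bullet> (z1 - x (Suc k)) + vy \<bullet> (z2 - y (Suc k))"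
        by (auto simp: z w_def norm_Pair)
      ultimately show ?thesis
        by (simp only: \<phi>_def s(3) flip: vx_def vy_def) (simp add: distrib_left)
    qed
    moreover have "norm ((vx, vy) + gradient H (w (Suc k))) \<le> C * d (Suc k)"
    proof -
      have ex: "norm (xt - x (Suc k)) \<le> E * d (Suc k)"
      proof -
        have "xt - x (Suc k) = \<beta> *\<^sub>R (x k - x (k - 1)) - (x (Suc k) - x k)" by (simp add: xt_def)
        then have "norm (xt - x (Suc k)) \<le> norm (\<beta> *\<^sub>R (x k - x (k - 1))) + norm (x (Suc k) - x k)"
          by (metis norm_triangle_ineq4)
        also have "\<dots> \<le> \<beta>max * d (Suc k) + d (Suc k)"
          using \<beta> d_ge(2)[of k] dxy(1)[of k] by (auto intro!: add_mono mult_mono)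
        finally show ?thesis by (simp add: E_def algebra_simps)
      qed
      have ey: "norm (yt - y (Suc k)) \<le> E * d (Suc k)"
      proof -
        have "yt - y (Suc k) = \<beta> *\<^sub>R (y k - y (k - 1)) - (y (Suc k) - y k)" by (simp add: yt_def)
        then have "norm (yt - y (Suc k)) \<le> norm (\<beta> *\<^sub>R (y k - y (k - 1))) + norm (y (Suc k) - y k)"
          by (metis norm_triangle_ineq4)
        also have "\<dots> \<le> \<beta>max * d (Suc k) + d (Suc k)"
          using \<beta> d_ge(3)[of k] dxy(2)[of k] by (auto intro!: add_mono mult_mono)
        finally show ?thesis by (simp add: E_def algebra_simps)
      qed
      have scale: "norm ((1 / \<tau>) *\<^sub>R v) \<le> 1 / \<tau>min * (E * d (Suc k))"
        if "\<tau>min \<le> \<tau>" "norm v \<le> E * d (Suc k)" for \<tau> and v :: "'c::real_normed_vector"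
        using that tau(1) order_trans[OF norm_ge_zero that(2)] by (auto intro!: mult_mono frac_le)
      \<comment> \<open>The x update used the gradient at the extrapolated x and the old y. Changing
        one argument at a time costs first L, then M.\<close>
      have "vx + gradient_x H (x (Suc k)) (y (Suc k)) = (1 / \<tau>1) *\<^sub>R (xt - x (Suc k))
          + (gradient_x H (x (Suc k)) (y k) - ?gx)
          + (gradient_x H (x (Suc k)) (y (Suc k)) - gradient_x H (x (Suc k)) (y k))"
        using \<tau>0 by (simp add: vx_def algebra_simps)
      moreover have "norm (gradient_x H (x (Suc k)) (y k) - ?gx) \<le> L * (E * d (Suc k))"
      proof -
        have "norm (gradient_x H (x (Suc k)) (y k) - ?gx) \<le> L1 (y k) * norm (xt - x (Suc k))"
          using lipschitz_onD[OF L1[of "y k"], of "x (Suc k)" xt] by (simp add: dist_norm norm_minus_commute)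
        also have "\<dots> \<le> L * (E * d (Suc k))" using L12 L0 ex by (intro mult_mono) auto
        finally show ?thesis .
      qed
      moreover have "norm (gradient_x H (x (Suc k)) (y (Suc k)) - gradient_x H (x (Suc k)) (y k)) \<le> M * d (Suc k)"
        using M(2)[OF xB yB yB] mult_left_mono[OF dxy(2)[of k] M(1)] by (rule order_trans)
      moreover note scale[OF \<tau>(1) ex]
      ultimately have nx: "norm (vx + gradient_x H (x (Suc k)) (y (Suc k)))
          \<le> 1 / \<tau>min * (E * d (Suc k)) + L * (E * d (Suc k)) + M * d (Suc k)"
        by (metis norm_triangle_mono)
      \<comment> \<open>The y update already used the new x, so only the extrapolated y has to be
        corrected.\<close>
      have "vy + gradient_y H (x (Suc k)) (y (Suc k)) = (1 / \<tau>2) *\<^sub>R (yt - y (Suc k))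
          + (gradient_y H (x (Suc k)) (y (Suc k)) - ?gy)"
        using \<tau>0 by (simp add: vy_def algebra_simps)
      moreover have "norm (gradient_y H (x (Suc k)) (y (Suc k)) - ?gy) \<le> L * (E * d (Suc k))"
      proof -
        have "norm (gradient_y H (x (Suc k)) (y (Suc k)) - ?gy) \<le> L2 (x (Suc k)) * norm (yt - y (Suc k))"
          using lipschitz_onD[OF L2[of "x (Suc k)"], of "y (Suc k)" yt] by (simp add: dist_norm norm_minus_commute)
        also have "\<dots> \<le> L * (E * d (Suc k))" using L12 L0 ey by (intro mult_mono) auto
        finally show ?thesis .
      qed
      moreover note scale[OF \<tau>(2) ey]
      ultimately have ny: "norm (vy + gradient_y H (x (Suc k)) (y (Suc k)))
          \<le> 1 / \<tau>min * (E * d (Suc k)) + L * (E * d (Suc k))"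
        by (metis norm_triangle_mono)
      have "(vx, vy) + gradient H (w (Suc k))
          = (vx + gradient_x H (x (Suc k)) (y (Suc k)), vy + gradient_y H (x (Suc k)) (y (Suc k)))"
        by (simp add: gradient_x_eq_fst[OF H] gradient_y_eq_snd[OF H] w_def prod_eq_iff)
      then have "norm ((vx, vy) + gradient H (w (Suc k)))
          \<le> norm (vx + gradient_x H (x (Suc k)) (y (Suc k))) + norm (vy + gradient_y H (x (Suc k)) (y (Suc k)))"
        by (metis norm_Pair_le)
      also have "\<dots> \<le> (1 / \<tau>min * (E * d (Suc k)) + L * (E * d (Suc k)) + M * d (Suc k))
          + (1 / \<tau>min * (E * d (Suc k)) + L * (E * d (Suc k)))"
        using nx ny by (rule add_mono)
      also have "\<dots> = C * d (Suc k)" by (simp only: C_def distrib_right mult.assoc)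
      finally show ?thesis .
    qed
    ultimately show ?thesis by blast
  qed
  then obtain v where v: "\<And>k z s. F z = ereal s \<Longrightarrow>
        \<phi> (Suc k) + v k \<bullet> (z - w (Suc k)) - 1 / (2 * \<tau>min) * (norm (z - w (Suc k)))\<^sup>2 \<le> s"
      "\<And>k. norm (v k + gradient H (w (Suc k))) \<le> C * d (Suc k)" by metis
  \<comment> \<open>\<open>v k\<close> is attached to the iterate with index \<open>Suc k\<close>,
    hence the shift; the term at index 0 is a dummy, as the locale constrains p at successors
    only.\<close>
  interpret prox_descent F H w "\<lambda>k. v (k - 1)" \<phi> u d "1 / (2 * \<tau>min)" C "\<delta> / 2" "\<alpha> / 2" b m
  proof
    show "F z \<noteq> -\<infinity>" for z using f_not[of "fst z"] g_not[of "snd z"] by (simp add: F_def)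
    show "lsc_fun (\<lambda>z. F z + ereal (H z))" using KL(1) by (simp add: KL_exponent_def Psi_eq)
    have "range w \<subseteq> B1 \<times> B2" using xB yB by (auto simp: w_def)
    then show "bounded (range w)"
      by (rule bounded_subset[OF bounded_Times[OF origin_ball_bounded[OF B1(1)] origin_ball_bounded[OF B2(1)]]])
    show "\<phi> (Suc k) + v (Suc k - 1) \<bullet> (z - w (Suc k)) - 1 / (2 * \<tau>min) * (norm (z - w (Suc k)))\<^sup>2 \<le> s"
      if "F z = ereal s" for k z s using v(1)[OF that] by simp
    show "norm (v (Suc k - 1) + gradient H (w (Suc k))) \<le> C * d (Suc k)" for k using v(2) by simp
  qed (use H F_w d_ge(1) u_ge u_le descent below C tau(1) delta(1) alpha(1) in auto)
  obtain \<omega> \<rho> \<gamma> where lim: "(\<lambda>k. \<phi> k + H (w k)) \<longlonglongrightarrow> \<omega>" and bounds: "0 < \<rho>" "\<rho> < 1" "0 < \<gamma>"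
    and rate: "\<forall>\<^sub>F k in sequentially. \<phi> k + H (w k) - \<omega> \<le>
      (if \<theta> = 1 / 2 then \<gamma> * \<rho> powi \<lceil>(real k - 1) / (real m + 1)\<rceil>
       else \<gamma> * real k powr ((1 - \<theta>) / (1 - 2 * \<theta>)))"
    by (rule KL_rate[OF KL[unfolded Psi_eq]])
  have "(\<lambda>k. Psi f g H (x k, y k)) \<longlonglongrightarrow> ereal \<omega>" using lim by (simp add: Psi_w)
  moreover have "\<forall>\<^sub>F k in sequentially. Psi f g H (x k, y k) - ereal \<omega> \<le>
      ereal (if \<theta> = 1 / 2 then \<gamma> * \<rho> powi \<lceil>(real k - 1) / (real m + 1)\<rceil>
             else \<gamma> * real k powr ((1 - \<theta>) / (1 - 2 * \<theta>)))"
    using rate by (simp only: Psi_w ereal_minus(1) ereal_less_eq(3))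
  ultimately show ?thesis using bounds by blast
qed

end
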